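(* Let $G=(U,V,E)$ be a bipartite graph and run the algorithm BBK described below on $G$. Let $\mathcal{B}$ be the number of maximal bicliques of $G$, $q$ the maximal size of a biclique $C$ of $G$ with $C_U\ne\emptyset$ and $C_V\neq\emptyset$, $d$ the maximum degree in $G$, $d_U=\max_{u\in U}|N(u)|$, $d_{2U}=\max_{u\in U}|N_2(u)|$, $\ell$ the total number of leaves of the recursive call trees of BBK, and $r=\mathcal{B}/\ell$. Then $1\le \frac{1}{r}\le 2^q$, and the time complexity of BBK is $\mathcal{O}\left(\frac{1}{r}\cdot(d_U+d_{2U})\cdot d\cdot q\cdot\mathcal{B}\right)$.
   Context: A bipartite graph is $G=(U,V,E)$ with $U,V$ disjoint vertex sets and $E\subseteq U\times V$ (undirected). For a vertex set $A$, write $A_U=A\cap U$ and $A_V=A\cap V$. A biclique is a set $C\subseteq U\cup V$ such that every vertex of $C_U$ is adjacent to every vertex of $C_V$; it is maximal if not strictly contained in another biclique. $N(x)$ is the neighborhood of $x$. For $u\in U$, $N_2(u)$ is the set of neighbors of neighbors of $u$ excluding $u$, and $N^{P}(u)=N(u)\cup N_2(u)$. A bidegeneracy order of $U$ is an ordering $u_1,\dots,u_{|U|}$ of $U$ such that for each $i$, $u_i$ minimizes $|N^{P}(u)\setminus\{u_1,\dots,u_{i-1}\}|$ over $u\in\{u_i,\dots,u_{|U|}\}$. Algorithm BBK: compute a bidegeneracy order $u_1,\dots,u_{|U|}$ of $U$; for each $i$, set $P_i=N^{P}(u_i)\setminus\{u_1,\dots,u_{i-1}\}$, $X_i=N^{P}(u_i)\cap\{u_1,\dots,u_{i-1}\}$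 and call $\mathrm{BKMBE}(\{u_i\},P_i,X_i)$ (the root of a call tree). The recursive procedure $\mathrm{BKMBE}(R,P,X)$ does: (1) if ($P_U=\emptyset$ or $P_V=\emptyset$) and $X=\emptyset$, output $R\cup P$ as a maximal biclique and return; (2) if ($P_U=\emptyset$ and $X_V\neq\emptyset$) or ($P_V=\emptyset$ and $X_U\ne\emptyset$), return; (3) choose a pivot $p\in P\cup X$ so as to minimize the size of the set $Q$ defined next: if $p\in U$ let $Q=P_V\setminus N(p)$, otherwise $Q=P_U\setminus N(p)$, and if $p\in P$ add $p$ to $Q$; (4) for each $x\in Q$: if $x\in U$ set $P_x=(P_U\setminus\{x\})\cup(P_V\cap N(x))$ and $X_x=X_U\cup(X_V\cap N(x))$, otherwise set $P_x=(P_V\setminus\{x\})\cup(P_U\cap N(x))$ and $X_x=X_V\cup(X_U\cap N(x))$; call $\mathrm{BKMBE}(R\cup\{x\},P_x,X_x)$ (a child in the call tree); then remove $x$ from $P$ and add $x$ to $X$. A leaf of a call tree is a call that makes no recursive call.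
   Formalization: The number of maximal bicliques counts only those with vertices in both U and V (else 1≤1/r fails on the path u1-v1-u2-v2-u3); 1/r≤2^q assumes no vertex of U is isolated (one edge plus many isolated vertices refutes it); G has an edge, so q is defined. *)

theory Defs
  imports "HOL-Library.Landau_Symbols" "HOL-Library.Monad_Syntax"
begin

section \<open>Bipartite graphs and bicliques\<close>

record 'a bigraph =
  left :: "'a set"
  right :: "'a set"
  edges :: "('a \<times> 'a) set"

definition bipartite_graph :: "'a bigraph \<Rightarrow> bool" where
  "bipartite_graph G \<longleftrightarrow> finite (left G) \<and> finite (right G) \<and> left G \<inter> right G = {} \<and>
     edges G \<subseteq> left G \<times> right G"

definition nbr :: "'a bigraph \<Rightarrow> 'a \<Rightarrow> 'a set" where
  "nbr G x = {y. (x, y) \<in> edges G \<or> (y, x) \<in> edges G}"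

definition nbr2 :: "'a bigraph \<Rightarrow> 'a \<Rightarrow> 'a set" where
  "nbr2 G u = (\<Union>v\<in>nbr G u. nbr G v) - {u}"

definition nbrP :: "'a bigraph \<Rightarrow> 'a \<Rightarrow> 'a set" where
  "nbrP G u = nbr G u \<union> nbr2 G u"

definition biclique :: "'a bigraph \<Rightarrow> 'a set \<Rightarrow> bool" where
  "biclique G C \<longleftrightarrow> C \<subseteq> left G \<union> right G \<and>
     (\<forall>u\<in>C \<inter> left G. \<forall>v\<in>C \<inter> right G. v \<in> nbr G u)"

definition maximal_biclique :: "'a bigraph \<Rightarrow> 'a set \<Rightarrow> bool" where
  "maximal_biclique G C \<longleftrightarrow> biclique G C \<and> \<not> (\<exists>C'. biclique G C' \<and> C \<subset> C')"

definition two_sided :: "'a bigraph \<Rightarrow> 'a set \<Rightarrow> bool" where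
  "two_sided G C \<longleftrightarrow> C \<inter> left G \<noteq> {} \<and> C \<inter> right G \<noteq> {}"

text \<open>
  \<^const>\<open>biclique\<close> admits sets that lie on one side of the graph, so \<^term>\<open>left G\<close> or
  \<^term>\<open>right G\<close> can be a maximal biclique.  Every vertex set handled by the algorithm contains a
  vertex of \<^term>\<open>left G\<close>, and only maximal bicliques with vertices on both sides are guaranteed
  to be enumerated; these are the ones that are counted.
\<close>
definition num_maximal_bicliques :: "'a bigraph \<Rightarrow> nat" where
  "num_maximal_bicliques G = card {C. maximal_biclique G C \<and> two_sided G C}"

text \<open>The maximum exists exactly if the graph has an edge.\<close>
definition max_biclique_size :: "'a bigraph \<Rightarrow> nat" where
  "max_biclique_size G = Max (card ` {C. biclique G C \<and> two_sided G C})"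

definition max_degree :: "'a bigraph \<Rightarrow> nat" where
  "max_degree G = Max ((\<lambda>x. card (nbr G x)) ` (left G \<union> right G))"

definition max_left_degree :: "'a bigraph \<Rightarrow> nat" where
  "max_left_degree G = Max ((\<lambda>u. card (nbr G u)) ` left G)"

definition max_left_degree2 :: "'a bigraph \<Rightarrow> nat" where
  "max_left_degree2 G = Max ((\<lambda>u. card (nbr2 G u)) ` left G)"

definition bidegeneracy_order :: "'a bigraph \<Rightarrow> 'a list \<Rightarrow> bool" where
  "bidegeneracy_order G us \<longleftrightarrow> distinct us \<and> set us = left G \<and>
     (\<forall>i j. i \<le> j \<and> j < length us \<longrightarrow>
        card (nbrP G (us ! i) - set (take i us)) \<le> card (nbrP G (us ! j) - set (take i us)))"


section \<open>Nondeterministic programs with a step count\<close>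

text \<open>
  A program is the set of its possible outcomes, each paired with the number of steps spent.
  All choices that the algorithm leaves open (iteration orders, ties) are nondeterministic.

  The machine model is a RAM on which sets and maps are hash tables: membership (in particular
  adjacency), insertion, deletion, lookup, update, cardinality and the test for emptiness are
  primitive, as are assignments and arithmetic on counters.  Each loop is charged one step for
  being entered and one for each iteration, and its body consists of boundedly many primitive
  operations besides nested programs.  A new set is always filled element by element;
  expressions such as \<^term>\<open>insert x A\<close> and \<^term>\<open>A - {x}\<close> in programs are updates in place of a
  set that is not used any more in its old form.
\<close>

type_synonym 'a prog = "('a \<times> nat) set"

definition ret :: "'a \<Rightarrow> 'a prog" where
  "ret x = {(x, 0)}"

definition bind_prog :: "'a prog \<Rightarrow> ('a \<Rightarrow> 'b prog) \<Rightarrow> 'b prog" where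
  "bind_prog m f = {(y, s + t) | x s y t. (x, s) \<in> m \<and> (y, t) \<in> f x}"

no_adhoc_overloading Monad_Syntax.bind \<rightleftharpoons> Set.bind
adhoc_overloading Monad_Syntax.bind \<rightleftharpoons> bind_prog

definition tick :: "unit prog" where
  "tick = {((), 1)}"

definition pick :: "'a set \<Rightarrow> 'a prog" where
  "pick A = {(x, 1) | x. x \<in> A}"

primrec for_list :: "'a list \<Rightarrow> ('a \<Rightarrow> 's \<Rightarrow> 's prog) \<Rightarrow> 's \<Rightarrow> 's prog" where
  "for_list [] f s = ret s"
| "for_list (x # xs) f s = do { tick; s' \<leftarrow> f x s; for_list xs f s' }"

definition foreach :: "'a set \<Rightarrow> ('a \<Rightarrow> 's \<Rightarrow> 's prog) \<Rightarrow> 's \<Rightarrow> 's prog" where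
  "foreach A f s = do {
     tick;
     (\<Union>xs\<in>{xs. distinct xs \<and> set xs = A}. for_list xs f s)
   }"

primrec repeat_prog :: "nat \<Rightarrow> ('s \<Rightarrow> 's prog) \<Rightarrow> 's \<Rightarrow> 's prog" where
  "repeat_prog 0 f s = ret s"
| "repeat_prog (Suc n) f s = do { tick; s' \<leftarrow> f s; repeat_prog n f s' }"

text \<open>Linear search for the first index with property \<open>Q\<close>, one step for each index tested.\<close>
definition first_index :: "(nat \<Rightarrow> bool) \<Rightarrow> nat prog" where
  "first_index Q = {(k, Suc k) | k. Q k \<and> (\<forall>j<k. \<not> Q j)}"

definition filter_set :: "('a \<Rightarrow> bool) \<Rightarrow> 'a set \<Rightarrow> 'a set prog" where
  "filter_set Q A = foreach A (\<lambda>x B. ret (if Q x then insert x B else B)) {}"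

definition copy_set :: "'a set \<Rightarrow> 'a set prog" where
  "copy_set A = filter_set (\<lambda>_. True) A"


section \<open>The recursive procedure BKMBE\<close>

definition same_side :: "'a bigraph \<Rightarrow> 'a \<Rightarrow> 'a \<Rightarrow> bool" where
  "same_side G x y \<longleftrightarrow> (x \<in> left G \<longleftrightarrow> y \<in> left G)"

definition opposite :: "'a bigraph \<Rightarrow> 'a \<Rightarrow> 'a set \<Rightarrow> 'a set" where
  "opposite G x A = (if x \<in> left G then A \<inter> right G else A \<inter> left G)"

definition pivot_set :: "'a bigraph \<Rightarrow> 'a set \<Rightarrow> 'a \<Rightarrow> 'a set" where
  "pivot_set G P p = (opposite G p P - nbr G p) \<union> (if p \<in> P then {p} else {})"

text \<open>
  The two parts of \<open>P\<close> (and of \<open>X\<close>) are kept as separate tables, so \<^term>\<open>opposite G p P\<close> and its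
  cardinality are directly available.  The size of \<^term>\<open>pivot_set G P p\<close> is obtained by
  scanning the neighbours of \<open>p\<close>.
\<close>
definition pivot_size :: "'a bigraph \<Rightarrow> 'a set \<Rightarrow> 'a \<Rightarrow> nat prog" where
  "pivot_size G P p = do {
     c \<leftarrow> foreach (nbr G p) (\<lambda>y c. ret (if y \<in> P then c + 1 else c)) 0;
     ret (card (opposite G p P) - c + (if p \<in> P then 1 else 0))
   }"

definition choose_pivot :: "'a bigraph \<Rightarrow> 'a set \<Rightarrow> 'a set \<Rightarrow> ('a \<times> nat) option prog" where
  "choose_pivot G P X = foreach (P \<union> X) (\<lambda>p best. do {
     k \<leftarrow> pivot_size G P p;
     ret (case best of
            None \<Rightarrow> Some (p, k)
          | Some (p', k') \<Rightarrow> if k < k' then Some (p, k) else Some (p', k'))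
   }) None"

definition build_pivot_set :: "'a bigraph \<Rightarrow> 'a set \<Rightarrow> 'a \<Rightarrow> 'a set prog" where
  "build_pivot_set G P p = do {
     Q \<leftarrow> filter_set (\<lambda>y. y \<notin> nbr G p) (opposite G p P);
     ret (if p \<in> P then insert p Q else Q)
   }"

definition child_P :: "'a bigraph \<Rightarrow> 'a \<Rightarrow> 'a set \<Rightarrow> 'a set prog" where
  "child_P G x P = filter_set (\<lambda>y. y \<noteq> x \<and> (same_side G x y \<or> y \<in> nbr G x)) P"

definition child_X :: "'a bigraph \<Rightarrow> 'a \<Rightarrow> 'a set \<Rightarrow> 'a set prog" where
  "child_X G x X = filter_set (\<lambda>y. same_side G x y \<or> y \<in> nbr G x) X"

text \<open>
  A call in a call tree carries the vertex set that it outputs, if any, and the trees of the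
  recursive calls that it makes.
\<close>
datatype 'a call_tree = Call (reported: "'a set option") (children: "'a call_tree list")

fun leaves :: "'a call_tree \<Rightarrow> nat" where
  "leaves (Call C Ts) = (if Ts = [] then 1 else (\<Sum>T\<leftarrow>Ts. leaves T))"

definition no_extension :: "'a bigraph \<Rightarrow> 'a set \<Rightarrow> 'a set \<Rightarrow> bool" where
  "no_extension G P X \<longleftrightarrow> (P \<inter> left G = {} \<or> P \<inter> right G = {}) \<and> X = {}"

definition not_maximal :: "'a bigraph \<Rightarrow> 'a set \<Rightarrow> 'a set \<Rightarrow> bool" where
  "not_maximal G P X \<longleftrightarrow> (P \<inter> left G = {} \<and> X \<inter> right G \<noteq> {}) \<or>
     (P \<inter> right G = {} \<and> X \<inter> left G \<noteq> {})"

text \<open>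
  \<open>bkmbe G R P X T t\<close>: the call on \<open>(R, P, X)\<close> may terminate with call tree \<open>T\<close> after \<open>t\<close> steps.
  \<open>bkmbe_loop G R P X xs Ts t\<close>: the loop over the remaining elements \<open>xs\<close> of \<open>Q\<close>, with the current
  values of \<open>P\<close> and \<open>X\<close>, may make recursive calls with trees \<open>Ts\<close> in \<open>t\<close> steps.
\<close>
inductive bkmbe :: "'a bigraph \<Rightarrow> 'a set \<Rightarrow> 'a set \<Rightarrow> 'a set \<Rightarrow> 'a call_tree \<Rightarrow> nat \<Rightarrow> bool"
  and bkmbe_loop :: "'a bigraph \<Rightarrow> 'a set \<Rightarrow> 'a set \<Rightarrow> 'a set \<Rightarrow> 'a list \<Rightarrow> 'a call_tree list \<Rightarrow> nat \<Rightarrow> bool"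
  for G :: "'a bigraph" where
  bkmbe_output:
    "\<lbrakk>no_extension G P X; (C, t) \<in> copy_set (R \<union> P)\<rbrakk>
     \<Longrightarrow> bkmbe G R P X (Call (Some C) []) (Suc t)"
| bkmbe_prune:
    "\<lbrakk>\<not> no_extension G P X; not_maximal G P X\<rbrakk>
     \<Longrightarrow> bkmbe G R P X (Call None []) 1"
| bkmbe_branch:
    "\<lbrakk>\<not> no_extension G P X; \<not> not_maximal G P X;
      (Some (p, k), t1) \<in> choose_pivot G P X; (Q, t2) \<in> build_pivot_set G P p;
      distinct xs; set xs = Q; bkmbe_loop G R P X xs Ts t3\<rbrakk>
     \<Longrightarrow> bkmbe G R P X (Call None Ts) (Suc (t1 + t2 + t3))"
| bkmbe_loop_Nil:
    "bkmbe_loop G R P X [] [] 1"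
| bkmbe_loop_Cons:
    "\<lbrakk>(R', s1) \<in> copy_set R; (P', s2) \<in> child_P G x P; (X', s3) \<in> child_X G x X;
      bkmbe G (insert x R') P' X' T t; bkmbe_loop G R (P - {x}) (insert x X) xs Ts t'\<rbrakk>
     \<Longrightarrow> bkmbe_loop G R P X (x # xs) (T # Ts) (Suc (s1 + s2 + s3 + t + t'))"


section \<open>The algorithm BBK\<close>

definition two_hop :: "'a bigraph \<Rightarrow> 'a \<Rightarrow> 'a set prog" where
  "two_hop G u = foreach (nbr G u) (\<lambda>v A.
     foreach (nbr G v) (\<lambda>w B. ret (if w = u then B else insert w B)) A) {}"

definition two_hop_table :: "'a bigraph \<Rightarrow> ('a \<Rightarrow> 'a set) prog" where
  "two_hop_table G = foreach (left G) (\<lambda>u N2. do {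
     A \<leftarrow> two_hop G u;
     ret (N2(u := A))
   }) (\<lambda>_. {})"

text \<open>
  A bidegeneracy order is computed by repeatedly extracting a vertex of minimum current degree
  \<open>\<bar>N\<^sup>P(u) - {removed vertices}\<bar>\<close>; bucket \<open>bkt k\<close> holds the remaining vertices of current
  degree \<open>k\<close>.
\<close>
definition init_buckets ::
  "'a bigraph \<Rightarrow> ('a \<Rightarrow> 'a set) \<Rightarrow> (('a \<Rightarrow> nat) \<times> (nat \<Rightarrow> 'a set)) prog" where
  "init_buckets G N2 = foreach (left G) (\<lambda>u (deg, bkt).
     let k = card (nbr G u) + card (N2 u)
     in ret (deg(u := k), bkt(k := insert u (bkt k)))) (\<lambda>_. 0, \<lambda>_. {})"

definition lower_degrees ::
  "'a set \<Rightarrow> 'a set \<Rightarrow> ('a \<Rightarrow> nat) \<times> (nat \<Rightarrow> 'a set) \<Rightarrow> (('a \<Rightarrow> nat) \<times> (nat \<Rightarrow> 'a set)) prog" where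
  "lower_degrees D A s = foreach A (\<lambda>w (deg, bkt).
     if w \<in> D then ret (deg, bkt)
     else
       let j = deg w; bkt' = bkt(j := bkt j - {w})
       in ret (deg(w := j - 1), bkt'(j - 1 := insert w (bkt' (j - 1))))) s"

definition extract_min ::
  "('a \<Rightarrow> 'a set) \<Rightarrow> 'a list \<times> 'a set \<times> ('a \<Rightarrow> nat) \<times> (nat \<Rightarrow> 'a set) \<Rightarrow>
   ('a list \<times> 'a set \<times> ('a \<Rightarrow> nat) \<times> (nat \<Rightarrow> 'a set)) prog" where
  "extract_min N2 = (\<lambda>(us, D, deg, bkt). do {
     k \<leftarrow> first_index (\<lambda>k. bkt k \<noteq> {});
     u \<leftarrow> pick (bkt k);
     (deg', bkt') \<leftarrow> lower_degrees (insert u D) (N2 u) (deg, bkt(k := bkt k - {u}));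
     ret (us @ [u], insert u D, deg', bkt')
   })"

definition compute_order :: "'a bigraph \<Rightarrow> ('a \<Rightarrow> 'a set) \<Rightarrow> 'a list prog" where
  "compute_order G N2 = do {
     (deg, bkt) \<leftarrow> init_buckets G N2;
     (us, D, deg', bkt') \<leftarrow> repeat_prog (card (left G)) (extract_min N2) ([], {}, deg, bkt);
     ret us
   }"

text \<open>The set \<open>D\<close> contains the vertices that precede the current one in the order.\<close>
primrec bbk_calls ::
  "'a bigraph \<Rightarrow> ('a \<Rightarrow> 'a set) \<Rightarrow> 'a set \<Rightarrow> 'a list \<Rightarrow> 'a call_tree list prog" where
  "bbk_calls G N2 D [] = do { tick; ret [] }"
| "bbk_calls G N2 D (u # us) = do {
     tick;
     P \<leftarrow> filter_set (\<lambda>x. x \<notin> D) (nbr G u \<union> N2 u);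
     X \<leftarrow> filter_set (\<lambda>x. x \<in> D) (nbr G u \<union> N2 u);
     T \<leftarrow> {(T, t). bkmbe G {u} P X T t};
     Ts \<leftarrow> bbk_calls G N2 (insert u D) us;
     ret (T # Ts)
   }"

text \<open>The outcomes of the algorithm: the list of its call trees and the number of steps.\<close>
definition bbk :: "'a bigraph \<Rightarrow> 'a call_tree list prog" where
  "bbk G = do {
     N2 \<leftarrow> two_hop_table G;
     us \<leftarrow> compute_order G N2;
     bbk_calls G N2 {} us
   }"

definition num_leaves :: "'a call_tree list \<Rightarrow> nat" where
  "num_leaves Ts = (\<Sum>T\<leftarrow>Ts. leaves T)"

text \<open>
  A vertex of \<^term>\<open>left G\<close> without neighbours yields a call tree with one leaf but belongs to no
  maximal biclique with vertices on both sides, so this ratio can only be bounded from below in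
  terms of \<^const>\<open>max_biclique_size\<close> if there are no such vertices.
\<close>
definition leaf_ratio :: "'a bigraph \<Rightarrow> 'a call_tree list \<Rightarrow> real" where
  "leaf_ratio G Ts = real (num_maximal_bicliques G) / real (num_leaves Ts)"


section \<open>Outcomes of the programs\<close>

text \<open>
  The programs compute the sets, pivots and orders that they are meant to compute, and every
  run terminates with an outcome; in particular \<open>bbk G\<close> is not empty.
\<close>

lemma in_bind_iff:
  "(y, t) \<in> bind_prog m f \<longleftrightarrow> (\<exists>x t1 t2. (x, t1) \<in> m \<and> (y, t2) \<in> f x \<and> t = t1 + t2)"
  by (auto simp: bind_prog_def)

lemma in_ret_iff: "(y, t) \<in> ret x \<longleftrightarrow> y = x \<and> t = 0"
  by (simp add: ret_def)

lemma in_tick_iff: "(y, t) \<in> tick \<longleftrightarrow> t = 1"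
  by (simp add: tick_def)

lemma bind_progI: "(x, t1) \<in> m \<Longrightarrow> (y, t2) \<in> f x \<Longrightarrow> (y, t1 + t2) \<in> bind_prog m f"
  by (auto simp: in_bind_iff)

lemmas prog_iff = in_bind_iff in_ret_iff in_tick_iff

lemma for_list_invariant:
  assumes "(s', t) \<in> for_list xs f s" "distinct xs" "set xs \<inter> B = {}" "set xs \<union> B = A" "I B s t0"
    and "\<And>C x r r' a b. C \<subseteq> A \<Longrightarrow> x \<in> A - C \<Longrightarrow> I C r a \<Longrightarrow> (r', b) \<in> f x r
           \<Longrightarrow> I (insert x C) r' (Suc (a + b))"
  shows "I A s' (t0 + t)"
  using assms(1-5)
proof (induction xs arbitrary: B s t t0)
  case Nil
  then show ?case by (simp add: prog_iff)
next
  case (Cons x xs)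
  obtain r b c where r: "(r, b) \<in> f x s" "(s', c) \<in> for_list xs f r" "t = Suc (b + c)"
    using Cons.prems(1) by (auto simp: prog_iff)
  have "I (insert x B) r (Suc (t0 + b))"
    using Cons.prems r(1) by (intro assms(6)[of B x s]) auto
  with Cons.prems r(2) have "I A s' (Suc (t0 + b) + c)"
    by (intro Cons.IH[of c r "insert x B"]) auto
  with r(3) show ?case by (simp add: add_ac)
qed

lemma foreach_invariant:
  assumes "(s', t) \<in> foreach A f s" "I {} s 0"
    and "\<And>C x r r' a b. C \<subseteq> A \<Longrightarrow> x \<in> A - C \<Longrightarrow> I C r a \<Longrightarrow> (r', b) \<in> f x r
           \<Longrightarrow> I (insert x C) r' (Suc (a + b))"
  shows "t \<ge> 1 \<and> I A s' (t - 1)"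
proof -
  from assms(1) obtain xs t' where "distinct xs" "set xs = A" "(s', t') \<in> for_list xs f s" "t = Suc t'"
    by (auto simp: foreach_def prog_iff)
  with for_list_invariant[of s' t' xs f s "{}" A I 0] assms(2,3) show ?thesis
    by simp
qed

lemma for_list_progress:
  assumes "distinct xs" "set xs \<inter> B = {}" "set xs \<union> B = A" "I B s"
    and "\<And>C x r. C \<subseteq> A \<Longrightarrow> x \<in> A - C \<Longrightarrow> I C r \<Longrightarrow> f x r \<noteq> {}"
    and "\<And>C x r r' b. C \<subseteq> A \<Longrightarrow> x \<in> A - C \<Longrightarrow> I C r \<Longrightarrow> (r', b) \<in> f x r \<Longrightarrow> I (insert x C) r'"
  shows "\<exists>s' t. (s', t) \<in> for_list xs f s"
  using assms(1-4)
proof (induction xs arbitrary: B s)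
  case Nil
  then show ?case by (auto simp: prog_iff)
next
  case (Cons x xs)
  have "f x s \<noteq> {}" using Cons.prems by (intro assms(5)[of B]) auto
  then obtain r b where r: "(r, b) \<in> f x s" by auto
  have "I (insert x B) r" using Cons.prems r by (intro assms(6)[of B x s]) auto
  with Cons.prems have "\<exists>s' t. (s', t) \<in> for_list xs f r"
    by (intro Cons.IH[of "insert x B"]) auto
  then obtain s' t where "(s', t) \<in> for_list xs f r" by blast
  with r have "(s', 1 + (b + t)) \<in> for_list (x # xs) f s"
    unfolding for_list.simps in_bind_iff in_tick_iff by blast
  then show ?case by blast
qed

lemma foreach_progress:
  assumes "finite A" "I {} s"
    and "\<And>C x r. C \<subseteq> A \<Longrightarrow> x \<in> A - C \<Longrightarrow> I C r \<Longrightarrow> f x r \<noteq> {}"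
    and "\<And>C x r r' b. C \<subseteq> A \<Longrightarrow> x \<in> A - C \<Longrightarrow> I C r \<Longrightarrow> (r', b) \<in> f x r \<Longrightarrow> I (insert x C) r'"
  shows "\<exists>s' t. (s', t) \<in> foreach A f s"
proof -
  obtain xs where xs: "distinct xs" "set xs = A"
    using finite_distinct_list[OF assms(1)] by auto
  have "\<exists>s' t. (s', t) \<in> for_list xs f s"
    by (rule for_list_progress[of xs "{}" A I]) (use xs assms in auto)
  with xs show ?thesis by (auto simp: foreach_def prog_iff)
qed

lemma foreach_total:
  assumes "finite A" "\<And>x r. x \<in> A \<Longrightarrow> f x r \<noteq> {}"
  shows "\<exists>s' t. (s', t) \<in> foreach A f s"
  by (rule foreach_progress[where I = "\<lambda>_ _. True"]) (use assms in auto)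

lemma filter_set_outcome:
  assumes "(B, t) \<in> filter_set Q A"
  shows "B = {x \<in> A. Q x}"
proof -
  have "t \<ge> 1 \<and> B = {x \<in> A. Q x}"
    using assms unfolding filter_set_def
    by (rule foreach_invariant[where I = "\<lambda>C B _. B = {x \<in> C. Q x}"]) (auto simp: prog_iff)
  then show ?thesis by simp
qed

lemma filter_set_total: "finite A \<Longrightarrow> \<exists>t. ({x \<in> A. Q x}, t) \<in> filter_set Q A"
  using foreach_total[of A "\<lambda>x B. ret (if Q x then insert x B else B)" "{}"] filter_set_outcome[of _ _ Q A]
  by (fastforce simp: ret_def filter_set_def)

lemma copy_set_outcome: "(B, t) \<in> copy_set A \<Longrightarrow> B = A"
  unfolding copy_set_def by (drule filter_set_outcome) simp

lemma copy_set_total: "finite A \<Longrightarrow> \<exists>t. (A, t) \<in> copy_set A"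
  unfolding copy_set_def using filter_set_total[of A "\<lambda>_. True"] by simp

lemma finite_nbr:
  assumes "bipartite_graph G"
  shows "finite (nbr G x)" "finite (nbr2 G x)" "finite (nbrP G x)"
proof -
  have 1: "nbr G y \<subseteq> left G \<union> right G" for y
    using assms by (auto simp: bipartite_graph_def nbr_def)
  moreover have fin: "finite (left G \<union> right G)"
    using assms by (auto simp: bipartite_graph_def)
  ultimately show "finite (nbr G x)" by (rule finite_subset)
  have "nbr2 G x \<subseteq> left G \<union> right G"
    using 1 by (auto simp: nbr2_def)
  then show "finite (nbr2 G x)" by (rule finite_subset) (rule fin)
  then show "finite (nbrP G x)" using \<open>finite (nbr G x)\<close> by (simp add: nbrP_def)
qed

lemma child_P_outcome:
  assumes "bipartite_graph G" "P \<subseteq> left G \<union> right G" "x \<in> P" "(P', t) \<in> child_P G x P"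
  shows "P' = (if x \<in> left G then (P \<inter> left G - {x}) \<union> (P \<inter> right G \<inter> nbr G x)
               else (P \<inter> right G - {x}) \<union> (P \<inter> left G \<inter> nbr G x))"
  using filter_set_outcome[OF assms(4)[unfolded child_P_def]] assms(1-3)
  by (auto simp: same_side_def bipartite_graph_def nbr_def)

lemma child_X_outcome:
  assumes "bipartite_graph G" "X \<subseteq> left G \<union> right G" "(X', t) \<in> child_X G x X"
  shows "X' = (if x \<in> left G then (X \<inter> left G) \<union> (X \<inter> right G \<inter> nbr G x)
               else (X \<inter> right G) \<union> (X \<inter> left G \<inter> nbr G x))"
  using filter_set_outcome[OF assms(3)[unfolded child_X_def]] assms(1,2)
  by (auto simp: same_side_def bipartite_graph_def nbr_def)

lemma build_pivot_set_outcome: "(Q, t) \<in> build_pivot_set G P p \<Longrightarrow> Q = pivot_set G P p"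
  by (auto simp: build_pivot_set_def prog_iff pivot_set_def dest!: filter_set_outcome split: if_splits)

lemma pivot_size_outcome:
  assumes "bipartite_graph G" "P \<subseteq> left G \<union> right G" "p \<in> left G \<union> right G"
    "(k, t) \<in> pivot_size G P p"
  shows "k = card (pivot_set G P p)"
proof -
  obtain c t' where c: "(c, t') \<in> foreach (nbr G p) (\<lambda>y c. ret (if y \<in> P then c + 1 else c)) 0"
    and k: "k = card (opposite G p P) - c + (if p \<in> P then 1 else 0)"
    using assms(4) by (auto simp: pivot_size_def prog_iff)
  have fin: "finite P" "finite (nbr G p)"
    using finite_subset[OF assms(2)] finite_nbr(1)[OF assms(1)] assms(1)
    by (simp_all add: bipartite_graph_def)
  have "t' \<ge> 1 \<and> c = card (nbr G p \<inter> P)"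
    using c
  proof (rule foreach_invariant[where I = "\<lambda>C c _. c = card (C \<inter> P)"])
    fix C y r r' a b
    assume *: "y \<in> nbr G p - C" "r = card (C \<inter> P)" "(r', b) \<in> ret (if y \<in> P then r + 1 else r)"
    have "finite (C \<inter> P)" "y \<notin> C \<inter> P" using fin(1) *(1) by simp_all
    then show "r' = card (insert y C \<inter> P)"
      using *(2,3) by (cases "y \<in> P") (auto simp: prog_iff Int_insert_left)
  qed simp
  also have "nbr G p \<inter> P = nbr G p \<inter> opposite G p P"
    using assms(1,2,3) by (auto simp: bipartite_graph_def nbr_def opposite_def)
  finally have "card (opposite G p P) - c = card (opposite G p P - nbr G p)"
    using fin by (simp add: card_Diff_subset_Int Int_commute)
  moreover have "p \<notin> opposite G p P"
    using assms(1,3) by (auto simp: opposite_def bipartite_graph_def)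
  moreover have "finite (opposite G p P)"
    using fin by (simp add: opposite_def)
  ultimately show ?thesis using k by (simp add: pivot_set_def)
qed

lemma choose_pivot_outcome:
  assumes "bipartite_graph G" "P \<subseteq> left G \<union> right G" "X \<subseteq> left G \<union> right G"
    "(best, t) \<in> choose_pivot G P X" "P \<union> X \<noteq> {}"
  shows "\<exists>p k. best = Some (p, k) \<and> p \<in> P \<union> X \<and>
           (\<forall>p'\<in>P \<union> X. card (pivot_set G P p) \<le> card (pivot_set G P p'))"
proof -
  define I where "I = (\<lambda>C (best :: ('a \<times> nat) option) (_ :: nat). case best of None \<Rightarrow> C = {}
     | Some (p, k) \<Rightarrow> p \<in> C \<and> k = card (pivot_set G P p) \<and>
         (\<forall>p'\<in>C. card (pivot_set G P p) \<le> card (pivot_set G P p')))"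
  have "t \<ge> 1 \<and> I (P \<union> X) best (t - 1)"
    using assms(4) unfolding choose_pivot_def
  proof (rule foreach_invariant)
    fix C x r r' a b
    assume *: "x \<in> P \<union> X - C" "I C r a"
      "(r', b) \<in> (do {
         k \<leftarrow> pivot_size G P x;
         ret (case r of None \<Rightarrow> Some (x, k)
            | Some (p', k') \<Rightarrow> if k < k' then Some (x, k) else Some (p', k'))
       })"
    then obtain k b' where "(k, b') \<in> pivot_size G P x" and r': "r' = (case r of None \<Rightarrow> Some (x, k)
            | Some (p', k') \<Rightarrow> if k < k' then Some (x, k) else Some (p', k'))"
      by (auto simp: prog_iff)
    then have "k = card (pivot_set G P x)"
      using assms(1-3) *(1) by (intro pivot_size_outcome) auto
    with r' *(2) show "I (insert x C) r' (Suc (a + b))"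
      by (cases r) (auto simp: I_def split: if_splits, metis le_trans less_imp_le)
  qed (simp add: I_def)
  with assms(5) show ?thesis
    by (auto simp: I_def split: option.splits)
qed

lemma choose_pivot_total:
  assumes "bipartite_graph G" "finite P" "finite X"
  shows "\<exists>best t. (best, t) \<in> choose_pivot G P X"
  unfolding choose_pivot_def
proof (rule foreach_total)
  fix p r
  obtain c :: nat and t where "(c, t) \<in> foreach (nbr G p) (\<lambda>y c. ret (if y \<in> P then c + 1 else c)) 0"
    using foreach_total[OF finite_nbr(1)[OF assms(1)], of p "\<lambda>y c. ret (if y \<in> P then c + 1 else c)" 0]
    by (auto simp: ret_def)
  then have "(card (opposite G p P) - c + (if p \<in> P then 1 else 0), t + 0) \<in> pivot_size G P p"
    unfolding pivot_size_def by (rule bind_progI) (simp add: in_ret_iff)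
  then obtain k t where k: "(k, t) \<in> pivot_size G P p" by blast
  show "(do {
      k \<leftarrow> pivot_size G P p;
      ret (case r of None \<Rightarrow> Some (p, k)
            | Some (p', k') \<Rightarrow> if k < k' then Some (p, k) else Some (p', k'))
    }) \<noteq> {}" (is "bind_prog _ ?f \<noteq> {}")
  proof -
    have "(case r of None \<Rightarrow> Some (p, k)
            | Some (p', k') \<Rightarrow> if k < k' then Some (p, k) else Some (p', k'), t + 0)
        \<in> bind_prog (pivot_size G P p) ?f"
      by (rule bind_progI[OF k]) (simp add: in_ret_iff)
    then show ?thesis by blast
  qed
qed (use assms in auto)

lemma two_hop_outcome:
  assumes "(A, t) \<in> two_hop G u"
  shows "A = nbr2 G u"
proof -
  have "t \<ge> 1 \<and> A = (\<Union>v\<in>nbr G u. nbr G v) - {u}"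
    using assms unfolding two_hop_def
  proof (rule foreach_invariant[where I = "\<lambda>C A _. A = (\<Union>v\<in>C. nbr G v) - {u}"])
    fix C v r r' a b
    assume r: "r = (\<Union>v\<in>C. nbr G v) - {u}"
      and loop: "(r', b) \<in> foreach (nbr G v) (\<lambda>w B. ret (if w = u then B else insert w B)) r"
    from loop have "b \<ge> 1 \<and> r' = r \<union> (nbr G v - {u})"
      by (rule foreach_invariant[where I = "\<lambda>C A _. A = r \<union> (C - {u})"]) (auto simp: prog_iff)
    with r show "r' = (\<Union>v\<in>insert v C. nbr G v) - {u}" by auto
  qed auto
  then show ?thesis by (simp add: nbr2_def)
qed

lemma two_hop_total: "bipartite_graph G \<Longrightarrow> \<exists>t. (nbr2 G u, t) \<in> two_hop G u"
proof -
  assume G: "bipartite_graph G"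
  have "\<exists>A t. (A, t) \<in> two_hop G u"
    unfolding two_hop_def
  proof (rule foreach_total)
    fix v r
    show "foreach (nbr G v) (\<lambda>w B. ret (if w = u then B else insert w B)) r \<noteq> {}"
      using foreach_total[OF finite_nbr(1)[OF G], of v "\<lambda>w B. ret (if w = u then B else insert w B)" r]
      by (auto simp: ret_def)
  qed (rule finite_nbr[OF G])
  then obtain A t where A: "(A, t) \<in> two_hop G u" by blast
  with two_hop_outcome[OF A] show ?thesis by auto
qed

lemma two_hop_table_outcome:
  assumes "(N2, t) \<in> two_hop_table G" "u \<in> left G"
  shows "N2 u = nbr2 G u"
proof -
  have "t \<ge> 1 \<and> (\<forall>u\<in>left G. N2 u = nbr2 G u)"
    using assms(1) unfolding two_hop_table_def
    by (rule foreach_invariant[where I = "\<lambda>C N2 _. \<forall>u\<in>C. N2 u = nbr2 G u"])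
       (auto simp: prog_iff dest!: two_hop_outcome split: if_splits)
  with assms(2) show ?thesis by blast
qed

lemma two_hop_table_total:
  assumes "bipartite_graph G"
  shows "\<exists>N2 t. (N2, t) \<in> two_hop_table G"
  unfolding two_hop_table_def
proof (rule foreach_total)
  fix u and r :: "'a \<Rightarrow> 'a set"
  show "(do { A \<leftarrow> two_hop G u; ret (r(u := A)) }) \<noteq> {}"
    using two_hop_total[OF assms, of u] unfolding bind_prog_def ret_def by blast
qed (use assms in \<open>simp add: bipartite_graph_def\<close>)


lemma nbr_sides:
  assumes "bipartite_graph G"
  shows "u \<in> left G \<Longrightarrow> nbr G u \<subseteq> right G" "v \<in> right G \<Longrightarrow> nbr G v \<subseteq> left G"
    "u \<in> left G \<Longrightarrow> nbr2 G u \<subseteq> left G"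
proof -
  show *: "u \<in> left G \<Longrightarrow> nbr G u \<subseteq> right G" "v \<in> right G \<Longrightarrow> nbr G v \<subseteq> left G" for u v
    using assms by (auto simp: bipartite_graph_def nbr_def)
  show "u \<in> left G \<Longrightarrow> nbr2 G u \<subseteq> left G"
    using * by (fastforce simp: nbr2_def)
qed

lemma in_nbr2_sym: "w \<in> nbr2 G u \<longleftrightarrow> u \<in> nbr2 G w"
  by (auto simp: nbr2_def nbr_def)

definition buckets_ok :: "'a set \<Rightarrow> ('a \<Rightarrow> nat) \<Rightarrow> (nat \<Rightarrow> 'a set) \<Rightarrow> bool" where
  "buckets_ok L deg bkt \<longleftrightarrow> (\<forall>k. bkt k = {w \<in> L. deg w = k})"

lemma init_buckets_outcome:
  assumes "bipartite_graph G" "\<And>u. u \<in> left G \<Longrightarrow> N2 u = nbr2 G u"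
    "((deg, bkt), t) \<in> init_buckets G N2"
  shows "buckets_ok (left G) deg bkt" "\<And>u. u \<in> left G \<Longrightarrow> deg u = card (nbrP G u)"
proof -
  have card: "card (nbr G u) + card (N2 u) = card (nbrP G u)" if "u \<in> left G" for u
  proof -
    have "nbr G u \<inter> nbr2 G u = {}"
      using nbr_sides(1,3)[OF assms(1) that] assms(1) by (auto simp: bipartite_graph_def)
    then show ?thesis
      using assms(2)[OF that] finite_nbr[OF assms(1), of u]
      by (simp add: nbrP_def card_Un_disjoint)
  qed
  define I where "I = (\<lambda>C (s :: ('a \<Rightarrow> nat) \<times> (nat \<Rightarrow> 'a set)) (_ :: nat).
    buckets_ok C (fst s) (snd s) \<and> (\<forall>u\<in>C. fst s u = card (nbrP G u)))"
  have "t \<ge> 1 \<and> I (left G) (deg, bkt) (t - 1)"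
    using assms(3) unfolding init_buckets_def
  proof (rule foreach_invariant)
    fix C x r r' a b
    assume "x \<in> left G - C" "I C r a"
      "(r', b) \<in> (case r of (deg, bkt) \<Rightarrow> let k = card (nbr G x) + card (N2 x)
         in ret (deg(x := k), bkt(k := insert x (bkt k))))"
    then show "I (insert x C) r' (Suc (a + b))"
      using card[of x]
      by (cases r) (auto simp: I_def buckets_ok_def Let_def prog_iff)
  qed (simp add: I_def buckets_ok_def)
  then show "buckets_ok (left G) deg bkt" "\<And>u. u \<in> left G \<Longrightarrow> deg u = card (nbrP G u)"
    by (auto simp: I_def)
qed

lemma init_buckets_total:
  assumes "bipartite_graph G"
  shows "\<exists>deg bkt t. ((deg, bkt), t) \<in> init_buckets G N2"
proof -
  have "\<exists>s t. (s, t) \<in> init_buckets G N2"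
    unfolding init_buckets_def
    by (rule foreach_total) (use assms in \<open>auto simp: bipartite_graph_def ret_def Let_def split: prod.splits\<close>)
  then show ?thesis by auto
qed

lemma lower_degrees_outcome:
  assumes "buckets_ok L deg bkt" "A - D \<subseteq> L" "\<And>w. w \<in> A - D \<Longrightarrow> deg w > 0"
    "((deg', bkt'), t) \<in> lower_degrees D A (deg, bkt)"
  shows "buckets_ok L deg' bkt'" "deg' w = deg w - (if w \<in> A - D then 1 else 0)"
proof -
  define I where "I = (\<lambda>C (s :: ('a \<Rightarrow> nat) \<times> (nat \<Rightarrow> 'a set)) (_ :: nat).
    buckets_ok L (fst s) (snd s) \<and> (\<forall>w. fst s w = deg w - (if w \<in> C - D then 1 else 0)))"
  have "t \<ge> 1 \<and> I A (deg', bkt') (t - 1)"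
    using assms(4) unfolding lower_degrees_def
  proof (rule foreach_invariant)
    fix C x r r' a b
    assume *: "x \<in> A - C" "I C r a"
      "(r', b) \<in> (case r of (deg, bkt) \<Rightarrow> if x \<in> D then ret (deg, bkt)
         else let j = deg x; bkt' = bkt(j := bkt j - {x})
           in ret (deg(x := j - 1), bkt'(j - 1 := insert x (bkt' (j - 1)))))"
    obtain dg bk where r: "r = (dg, bk)" by (cases r)
    show "I (insert x C) r' (Suc (a + b))"
    proof (cases "x \<in> D")
      case True
      with * r show ?thesis by (auto simp: I_def prog_iff)
    next
      case False
      then have "x \<in> L" "dg x > 0" "dg x = deg x"
        using * assms(2) assms(3)[of x] r by (auto simp: I_def)
      moreover have r': "r' = (dg(x := dg x - 1),
          (bk(dg x := bk (dg x) - {x}))(dg x - 1 := insert x ((bk(dg x := bk (dg x) - {x})) (dg x - 1))))"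
        using * r False by (auto simp: Let_def prog_iff)
      ultimately have "buckets_ok L (fst r') (snd r')"
        using *(2) r by (auto simp: I_def buckets_ok_def)
      moreover have "\<forall>w. fst r' w = deg w - (if w \<in> insert x C - D then 1 else 0)"
        using *(2) r r' False \<open>dg x = deg x\<close> by (auto simp: I_def)
      ultimately show ?thesis by (simp add: I_def)
    qed
  qed (use assms(1) in \<open>simp add: I_def\<close>)
  then show "buckets_ok L deg' bkt'" "deg' w = deg w - (if w \<in> A - D then 1 else 0)"
    by (auto simp: I_def)
qed

lemma lower_degrees_total:
  assumes "finite A"
  shows "\<exists>deg' bkt' t. ((deg', bkt'), t) \<in> lower_degrees D A s"
proof -
  have "\<exists>s' t. (s', t) \<in> lower_degrees D A s"
    unfolding lower_degrees_def
    by (rule foreach_total) (use assms in \<open>auto simp: ret_def Let_def split: prod.splits\<close>)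
  then show ?thesis by auto
qed

definition order_inv ::
  "'a bigraph \<Rightarrow> nat \<Rightarrow> 'a list \<times> 'a set \<times> ('a \<Rightarrow> nat) \<times> (nat \<Rightarrow> 'a set) \<Rightarrow> bool" where
  "order_inv G n = (\<lambda>(us, D, deg, bkt). length us = n \<and> distinct us \<and> set us = D \<and> D \<subseteq> left G \<and>
     buckets_ok (left G - D) deg bkt \<and> (\<forall>w\<in>left G - D. deg w = card (nbrP G w - D)) \<and>
     (\<forall>i<n. \<forall>w\<in>left G - set (take i us).
        card (nbrP G (us ! i) - set (take i us)) \<le> card (nbrP G w - set (take i us))))"

lemma extract_min_outcome:
  assumes G: "bipartite_graph G" and N2: "\<And>u. u \<in> left G \<Longrightarrow> N2 u = nbr2 G u"
    and inv: "order_inv G n s" and out: "(s', t) \<in> extract_min N2 s"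
  shows "order_inv G (Suc n) s'"
proof -
  obtain us D deg bkt where s: "s = (us, D, deg, bkt)" by (cases s)
  from out s obtain k u deg' bkt' t' where
    k: "bkt k \<noteq> {}" "\<forall>j<k. bkt j = {}" and u: "u \<in> bkt k" and
    low: "((deg', bkt'), t') \<in> lower_degrees (insert u D) (N2 u) (deg, bkt(k := bkt k - {u}))" and
    s': "s' = (us @ [u], insert u D, deg', bkt')"
    unfolding extract_min_def first_index_def pick_def by (clarsimp simp: prog_iff)
  have I: "length us = n" "distinct us" "set us = D" "D \<subseteq> left G" "buckets_ok (left G - D) deg bkt"
    "\<And>w. w \<in> left G - D \<Longrightarrow> deg w = card (nbrP G w - D)"
    "\<And>i w. i < n \<Longrightarrow> w \<in> left G - set (take i us) \<Longrightarrow>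
        card (nbrP G (us ! i) - set (take i us)) \<le> card (nbrP G w - set (take i us))"
    using inv s by (auto simp: order_inv_def)
  have uL: "u \<in> left G" "u \<notin> D" "deg u = k"
    using u I(5) by (auto simp: buckets_ok_def)
  have ok: "buckets_ok (left G - insert u D) deg (bkt(k := bkt k - {u}))"
    using I(5) uL by (auto simp: buckets_ok_def)
  have mem: "u \<in> nbrP G w \<longleftrightarrow> w \<in> nbr2 G u" if "w \<in> left G" for w
    using nbr_sides(1)[OF G that] uL(1) G in_nbr2_sym[of w G u]
    by (auto simp: nbrP_def bipartite_graph_def)
  have pos: "deg w = Suc (card (nbrP G w - insert u D))"
    if "w \<in> nbr2 G u" "w \<in> left G" "w \<notin> D" for w
  proof -
    have eq: "nbrP G w - D = insert u (nbrP G w - insert u D)"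
      using mem[OF that(2)] that(1) uL by auto
    have "deg w = card (nbrP G w - D)" using I(6)[of w] that by blast
    also have "\<dots> = card (insert u (nbrP G w - insert u D))" by (simp only: eq)
    also have "\<dots> = Suc (card (nbrP G w - insert u D))"
      by (rule card_insert_disjoint) (use finite_nbr(3)[OF G, of w] in auto)
    finally show ?thesis .
  qed
  have sub: "nbr2 G u \<subseteq> left G" by (rule nbr_sides(3)[OF G uL(1)])
  note low' = lower_degrees_outcome[OF ok _ _ low]
  have 1: "buckets_ok (left G - insert u D) deg' bkt'"
    by (rule low'(1)) (use sub pos N2[OF uL(1)] in auto)
  have 2: "deg' w = card (nbrP G w - insert u D)" if "w \<in> left G - insert u D" for w
  proof -
    have "deg' w = deg w - (if w \<in> N2 u - insert u D then 1 else 0)"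
      by (rule low'(2)) (use sub pos N2[OF uL(1)] in auto)
    moreover have "nbrP G w - insert u D = nbrP G w - D" if "w \<notin> nbr2 G u"
      using mem[of w] that \<open>w \<in> left G - insert u D\<close> by auto
    ultimately show ?thesis
      using pos[of w] that N2[OF uL(1)] I(6)[of w] by auto
  qed
  have min: "card (nbrP G u - D) \<le> card (nbrP G w - D)" if "w \<in> left G - D" for w
  proof -
    have "w \<in> bkt (deg w)" using I(5) that by (auto simp: buckets_ok_def)
    then have "k \<le> deg w" using k(2) by (metis empty_iff not_le_imp_less)
    then show ?thesis using I(6)[of w] I(6)[of u] uL that by auto
  qed
  have "card (nbrP G ((us @ [u]) ! i) - set (take i (us @ [u])))
      \<le> card (nbrP G w - set (take i (us @ [u])))"
    if "i < Suc n" "w \<in> left G - set (take i (us @ [u]))" for i w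
    using that I(7)[of i w] min[of w] I(1,3) by (cases "i < n") (auto simp: nth_append less_Suc_eq)
  then show ?thesis
    using 1 2 I(1-4) uL s' by (auto simp: order_inv_def)
qed

lemma extract_min_total:
  assumes G: "bipartite_graph G" and N2: "\<And>u. u \<in> left G \<Longrightarrow> N2 u = nbr2 G u"
    and inv: "order_inv G n s" and n: "n < card (left G)"
  shows "\<exists>s' t. (s', t) \<in> extract_min N2 s"
proof -
  obtain us D deg bkt where s: "s = (us, D, deg, bkt)" by (cases s)
  have I: "length us = n" "distinct us" "set us = D" "D \<subseteq> left G" "buckets_ok (left G - D) deg bkt"
    using inv s by (auto simp: order_inv_def)
  have "card D = n" using I(1-3) distinct_card by fastforce
  then obtain w where "w \<in> left G - D"
    using n I(4) by (metis Diff_iff less_irrefl subsetI subset_antisym)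
  then have ex: "bkt (deg w) \<noteq> {}" using I(5) by (auto simp: buckets_ok_def)
  define k where "k = (LEAST k. bkt k \<noteq> {})"
  have k: "bkt k \<noteq> {}" unfolding k_def using ex by (rule LeastI)
  have k': "\<forall>j<k. bkt j = {}" unfolding k_def using not_less_Least by blast
  obtain u where u: "u \<in> bkt k" using k by auto
  then have "u \<in> left G" using I(5) by (auto simp: buckets_ok_def)
  then have "finite (N2 u)" using N2 finite_nbr[OF G] by simp
  from lower_degrees_total[OF this, of "insert u D" "(deg, bkt(k := bkt k - {u}))"]
  obtain deg' bkt' t' where
    "((deg', bkt'), t') \<in> lower_degrees (insert u D) (N2 u) (deg, bkt(k := bkt k - {u}))" by auto
  moreover have "(k, Suc k) \<in> first_index (\<lambda>k. bkt k \<noteq> {})" "(u, 1) \<in> pick (bkt k)"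
    using k k' u by (auto simp: first_index_def pick_def)
  ultimately have "((us @ [u], insert u D, deg', bkt'), Suc k + (1 + (t' + 0))) \<in> extract_min N2 s"
    unfolding s extract_min_def prod.case
    by (intro bind_progI[of k] bind_progI[of u] bind_progI[of "(deg', bkt')"]) (auto simp: in_ret_iff)
  then show ?thesis by blast
qed

lemma repeat_prog_order_inv:
  assumes "bipartite_graph G" "\<And>u. u \<in> left G \<Longrightarrow> N2 u = nbr2 G u"
    "order_inv G n s" "(s', t) \<in> repeat_prog m (extract_min N2) s"
  shows "order_inv G (n + m) s'"
  using assms(3,4)
proof (induction m arbitrary: n s t)
  case 0
  then show ?case by (simp add: prog_iff)
next
  case (Suc m)
  then obtain r a b where "(r, a) \<in> extract_min N2 s" "(s', b) \<in> repeat_prog m (extract_min N2) r"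
    by (auto simp: prog_iff)
  with Suc extract_min_outcome[OF assms(1,2) Suc.prems(1)] show ?case
    by (metis add_Suc_shift)
qed

lemma repeat_prog_order_total:
  assumes "bipartite_graph G" "\<And>u. u \<in> left G \<Longrightarrow> N2 u = nbr2 G u"
    "order_inv G n s" "n + m \<le> card (left G)"
  shows "\<exists>s' t. (s', t) \<in> repeat_prog m (extract_min N2) s"
  using assms(3,4)
proof (induction m arbitrary: n s)
  case 0
  then show ?case by (auto simp: prog_iff)
next
  case (Suc m)
  then obtain r a where r: "(r, a) \<in> extract_min N2 s"
    using extract_min_total[OF assms(1,2) Suc.prems(1)] by auto
  with Suc extract_min_outcome[OF assms(1,2) Suc.prems(1)]
  have "\<exists>s' t. (s', t) \<in> repeat_prog m (extract_min N2) r"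
    by (metis add_Suc_shift)
  then obtain s' t where "(s', t) \<in> repeat_prog m (extract_min N2) r" by blast
  with r have "(s', 1 + (a + t)) \<in> repeat_prog (Suc m) (extract_min N2) s"
    unfolding repeat_prog.simps by (intro bind_progI) (auto simp: in_tick_iff)
  then show ?case by blast
qed

lemma order_inv_init:
  assumes "bipartite_graph G" "\<And>u. u \<in> left G \<Longrightarrow> N2 u = nbr2 G u"
    "((deg, bkt), t) \<in> init_buckets G N2"
  shows "order_inv G 0 ([], {}, deg, bkt)"
  using init_buckets_outcome[OF assms] by (simp add: order_inv_def)

lemma compute_order_outcome:
  assumes "bipartite_graph G" "\<And>u. u \<in> left G \<Longrightarrow> N2 u = nbr2 G u"
    "(us, t) \<in> compute_order G N2"
  shows "bidegeneracy_order G us"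
proof -
  from assms(3) obtain deg bkt t1 D deg' bkt' t2 where
    1: "((deg, bkt), t1) \<in> init_buckets G N2" and
    2: "((us, D, deg', bkt'), t2) \<in> repeat_prog (card (left G)) (extract_min N2) ([], {}, deg, bkt)"
    by (auto simp: compute_order_def prog_iff)
  from repeat_prog_order_inv[OF assms(1,2) order_inv_init[OF assms(1,2) 1] 2]
  have I: "length us = card (left G)" "distinct us" "set us \<subseteq> left G"
    "\<And>i w. i < card (left G) \<Longrightarrow> w \<in> left G - set (take i us) \<Longrightarrow>
        card (nbrP G (us ! i) - set (take i us)) \<le> card (nbrP G w - set (take i us))"
    by (auto simp: order_inv_def)
  have "finite (left G)" using assms(1) by (simp add: bipartite_graph_def)
  then have set: "set us = left G"
    using I(1-3) by (metis card_subset_eq distinct_card)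
  have "us ! j \<in> left G - set (take i us)" if "i \<le> j" "j < length us" for i j
    using that I(2) set nth_mem[of j us]
    by (auto simp: in_set_conv_nth nth_eq_iff_index_eq)
  with I set show ?thesis by (auto simp: bidegeneracy_order_def)
qed

lemma compute_order_total:
  assumes "bipartite_graph G" "\<And>u. u \<in> left G \<Longrightarrow> N2 u = nbr2 G u"
  shows "\<exists>us t. (us, t) \<in> compute_order G N2"
proof -
  obtain deg bkt t1 where 1: "((deg, bkt), t1) \<in> init_buckets G N2"
    using init_buckets_total[OF assms(1)] by blast
  obtain us D deg' bkt' t2 where
    2: "((us, D, deg', bkt'), t2) \<in> repeat_prog (card (left G)) (extract_min N2) ([], {}, deg, bkt)"
    using repeat_prog_order_total[OF assms order_inv_init[OF assms 1], of "card (left G)"] by auto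
  have "(us, t1 + (t2 + 0)) \<in> compute_order G N2"
    unfolding compute_order_def
    by (rule bind_progI[OF 1]) (simp only: prod.case, rule bind_progI[OF 2], simp add: in_ret_iff)
  then show ?thesis by blast
qed

lemma bkmbe_total:
  assumes G: "bipartite_graph G"
    and fin: "finite R" "P \<subseteq> left G \<union> right G" "X \<subseteq> left G \<union> right G"
  shows "\<exists>T t. bkmbe G R P X T t"
proof -
  have fG: "finite (left G \<union> right G)" using G by (simp add: bipartite_graph_def)
  show ?thesis
    using fin
  proof (induction "card P" arbitrary: R P X rule: less_induct)
    case less
    have fP: "finite P" and fX: "finite X"
      using less.prems fG finite_subset by auto
    consider "no_extension G P X" | "\<not> no_extension G P X" "not_maximal G P X"
      | "\<not> no_extension G P X" "\<not> not_maximal G P X" by blast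
    then show ?case
    proof cases
      case 1
      then show ?thesis using copy_set_total[of "R \<union> P"] less.prems(1) fP bkmbe_output by blast
    next
      case 2
      then show ?thesis using bkmbe_prune by blast
    next
      case 3
      then have ne: "P \<union> X \<noteq> {}" by (auto simp: no_extension_def)
      obtain best t1 where best: "(best, t1) \<in> choose_pivot G P X"
        using choose_pivot_total[OF G fP fX] by blast
      with choose_pivot_outcome[OF G less.prems(2,3) _ ne] obtain p k where "best = Some (p, k)"
        by blast
      with best have piv: "(Some (p, k), t1) \<in> choose_pivot G P X" by simp
      have "finite (opposite G p P)" using fP by (simp add: opposite_def)
      from filter_set_total[OF this, of "\<lambda>y. y \<notin> nbr G p"]
      have "\<exists>Q t. (Q, t) \<in> build_pivot_set G P p"
        unfolding build_pivot_set_def bind_prog_def ret_def by blast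
      then obtain Q t2 where Q: "(Q, t2) \<in> build_pivot_set G P p" by blast
      have Q_eq: "Q = pivot_set G P p" by (rule build_pivot_set_outcome[OF Q])
      have QP: "Q \<subseteq> P" using Q_eq by (auto simp: pivot_set_def opposite_def)
      then obtain xs where xs: "set xs = Q" "distinct xs"
        using fP finite_distinct_list[of Q] finite_subset by blast
      have "\<exists>Ts t. bkmbe_loop G R P' X' xs Ts t"
        if "set xs \<subseteq> P'" "P' \<subseteq> P" "X' \<subseteq> left G \<union> right G" "distinct xs" for P' X' xs
        using that
      proof (induction xs arbitrary: P' X')
        case Nil
        then show ?case using bkmbe_loop_Nil by blast
      next
        case (Cons x xs)
        have f: "finite P'" "finite X'" using Cons.prems fP fG finite_subset by blast+
        obtain s1 where R': "(R, s1) \<in> copy_set R"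
          using copy_set_total[OF less.prems(1)] by blast
        obtain PP s2 where PP: "(PP, s2) \<in> child_P G x P'"
          using filter_set_total[OF f(1)] unfolding child_P_def by blast
        obtain XX s3 where XX: "(XX, s3) \<in> child_X G x X'"
          using filter_set_total[OF f(2)] unfolding child_X_def by blast
        have sub: "PP \<subseteq> P' - {x}" "XX \<subseteq> X'"
          using PP XX by (auto simp: child_P_def child_X_def dest: filter_set_outcome)
        have "card PP < card P'"
          using sub(1) f(1) Cons.prems(1) by (intro psubset_card_mono) auto
        also have "\<dots> \<le> card P" by (rule card_mono[OF fP Cons.prems(2)])
        finally have lt: "card PP < card P" .
        obtain T t where T: "bkmbe G (insert x R) PP XX T t"
          using less.hyps[OF lt, of "insert x R" XX] sub Cons.prems less.prems by blast
        have "x \<in> left G \<union> right G" using Cons.prems less.prems by auto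
        then have "set xs \<subseteq> P' - {x}" "P' - {x} \<subseteq> P" "insert x X' \<subseteq> left G \<union> right G" "distinct xs"
          using Cons.prems by auto
        from Cons.IH[OF this] obtain Ts t' where Ts: "bkmbe_loop G R (P' - {x}) (insert x X') xs Ts t'"
          by blast
        show ?case using bkmbe_loop_Cons[OF R' PP XX T Ts] by blast
      qed
      from this[of xs P X] obtain Ts t3 where "bkmbe_loop G R P X xs Ts t3"
        using xs QP less.prems by blast
      from bkmbe_branch[OF 3 piv Q xs(2,1) this] show ?thesis by blast
    qed
  qed
qed

lemma bbk_calls_total:
  assumes G: "bipartite_graph G" and N2: "\<And>u. u \<in> left G \<Longrightarrow> N2 u = nbr2 G u"
    and us: "set us \<subseteq> left G"
  shows "\<exists>Ts t. (Ts, t) \<in> bbk_calls G N2 D us"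
  using us
proof (induction us arbitrary: D)
  case Nil
  then show ?case by (auto simp: prog_iff)
next
  case (Cons u us)
  have u: "u \<in> left G" using Cons.prems by simp
  have sub: "nbr G u \<union> N2 u \<subseteq> left G \<union> right G"
    using nbr_sides(1,3)[OF G u] N2[OF u] by auto
  have fin: "finite (nbr G u \<union> N2 u)"
    using finite_nbr[OF G, of u] N2[OF u] by auto
  obtain t1 t2 where
    1: "({x \<in> nbr G u \<union> N2 u. x \<notin> D}, t1) \<in> filter_set (\<lambda>x. x \<notin> D) (nbr G u \<union> N2 u)" and
    2: "({x \<in> nbr G u \<union> N2 u. x \<in> D}, t2) \<in> filter_set (\<lambda>x. x \<in> D) (nbr G u \<union> N2 u)"
    using filter_set_total[OF fin, of "\<lambda>x. x \<notin> D"] filter_set_total[OF fin, of "\<lambda>x. x \<in> D"] by blast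
  have sub': "{x \<in> nbr G u \<union> N2 u. x \<notin> D} \<subseteq> left G \<union> right G"
    "{x \<in> nbr G u \<union> N2 u. x \<in> D} \<subseteq> left G \<union> right G"
    using sub by auto
  obtain T t3 where 3: "bkmbe G {u} {x \<in> nbr G u \<union> N2 u. x \<notin> D} {x \<in> nbr G u \<union> N2 u. x \<in> D} T t3"
    using bkmbe_total[OF G _ sub', of "{u}"] by auto
  obtain Ts t4 where 4: "(Ts, t4) \<in> bbk_calls G N2 (insert u D) us"
    using Cons.IH[of "insert u D"] Cons.prems by auto
  have "(T # Ts, 1 + (t1 + (t2 + (t3 + (t4 + 0))))) \<in> bbk_calls G N2 D (u # us)"
    unfolding bbk_calls.simps
    by (rule bind_progI, simp add: in_tick_iff, rule bind_progI, rule 1, rule bind_progI, rule 2,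
        rule bind_progI[of T], use 3 in simp, rule bind_progI, rule 4, simp add: in_ret_iff)
  then show ?case by blast
qed

lemma bbk_total:
  assumes "bipartite_graph G"
  shows "\<exists>Ts t. (Ts, t) \<in> bbk G"
proof -
  obtain N2 t1 where N2: "(N2, t1) \<in> two_hop_table G"
    using two_hop_table_total[OF assms] by blast
  note N2' = two_hop_table_outcome[OF N2]
  obtain us t2 where us: "(us, t2) \<in> compute_order G N2"
    using compute_order_total[OF assms N2'] by blast
  have "set us \<subseteq> left G"
    using compute_order_outcome[OF assms N2' us] by (simp add: bidegeneracy_order_def)
  then obtain Ts t3 where "(Ts, t3) \<in> bbk_calls G N2 {} us"
    using bbk_calls_total[OF assms N2'] by blast
  with N2 us show ?thesis
    unfolding bbk_def by (blast intro: bind_progI)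
qed

end

theory Submission
  imports Defs
begin

text \<open>
  Bicliques are the cliques of the relation ``on the same side or adjacent'', so completeness of the
  enumeration is the usual argument for Bron--Kerbosch with pivoting, which gives at least one leaf
  for each maximal biclique.

  For the upper bound, call a set extendable if the vertices in it from \<^term>\<open>left G\<close> have a common
  neighbour.  By induction, an extendable call \<open>(R, P, X)\<close> has at most as many leaves as there are
  extendable bicliques between \<open>R\<close> and \<open>R \<union> P\<close>, and every other call is a leaf.  Each extendable
  biclique with a vertex in \<^term>\<open>left G\<close> is a subset of a maximal biclique with vertices on both
  sides, which has at most \<open>2\<^sup>q\<close> subsets.

  Calls that branch are extendable, so that \<open>\<bar>R\<bar> \<le> q\<close> there and the call trees have depth at most
  \<open>q\<close>.  A call takes time \<open>O((d\<^sub>U + d\<^sub>2\<^sub>U) d)\<close>, and there are at most \<open>q + 1\<close> calls for each leaf.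
\<close>

section \<open>Bicliques as cliques\<close>

text \<open>Counting vertices on the same side as linked makes this relation the filter of
  \<open>child_X\<close>, and that of \<open>child_P\<close> up to \<open>y \<noteq> x\<close>, so
  the side of \<open>x\<close> needs no case distinction.\<close>

definition linked :: "'a bigraph \<Rightarrow> 'a \<Rightarrow> 'a \<Rightarrow> bool" where
  "linked G x y \<longleftrightarrow> same_side G x y \<or> y \<in> nbr G x"

definition linked_set :: "'a bigraph \<Rightarrow> 'a set \<Rightarrow> bool" where
  "linked_set G S \<longleftrightarrow> (\<forall>x\<in>S. \<forall>y\<in>S. linked G x y)"

text \<open>In a bipartite graph, vertices of \<open>S\<close> on the right are linked to
  \<open>v\<close> anyway, so only those on the left constrain it. The witness \<open>v\<close> may
  itself lie in \<open>S\<close>.\<close>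

definition extendable :: "'a bigraph \<Rightarrow> 'a set \<Rightarrow> bool" where
  "extendable G S \<longleftrightarrow> (\<exists>v\<in>right G. \<forall>x\<in>S. linked G x v)"

lemma linked_sym: "linked G x y \<longleftrightarrow> linked G y x"
  by (auto simp: linked_def same_side_def nbr_def)

lemma linked_refl [simp]: "linked G x x"
  by (simp add: linked_def same_side_def)

lemma linked_left_right:
  "bipartite_graph G \<Longrightarrow> u \<in> left G \<Longrightarrow> v \<in> right G \<Longrightarrow> linked G u v \<longleftrightarrow> v \<in> nbr G u"
  by (auto simp: linked_def same_side_def bipartite_graph_def)

lemma linked_same_side:
  "u \<in> left G \<Longrightarrow> v \<in> left G \<Longrightarrow> linked G u v"
  "bipartite_graph G \<Longrightarrow> u \<in> right G \<Longrightarrow> v \<in> right G \<Longrightarrow> linked G u v"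
  by (auto simp: linked_def same_side_def bipartite_graph_def)

lemma biclique_iff:
  assumes "bipartite_graph G"
  shows "biclique G S \<longleftrightarrow> S \<subseteq> left G \<union> right G \<and> linked_set G S"
proof (intro iffI conjI)
  assume S: "biclique G S"
  then show sub: "S \<subseteq> left G \<union> right G" by (simp add: biclique_def)
  show "linked_set G S"
    unfolding linked_set_def
  proof (intro ballI)
    fix x y assume xy: "x \<in> S" "y \<in> S"
    with sub consider "x \<in> left G" "y \<in> left G" | "x \<in> left G" "y \<in> right G"
      | "x \<in> right G" "y \<in> left G" | "x \<in> right G" "y \<in> right G" by blast
    then show "linked G x y"
    proof cases
      case 2
      with S xy show ?thesis by (auto simp: biclique_def linked_def)
    next
      case 3
      with S xy have "linked G y x" by (auto simp: biclique_def linked_def)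
      then show ?thesis by (simp only: linked_sym[of G x y])
    qed (simp_all add: linked_same_side assms)
  qed
next
  assume "S \<subseteq> left G \<union> right G \<and> linked_set G S"
  with assms show "biclique G S"
    using linked_left_right[OF assms] unfolding biclique_def linked_set_def by blast
qed

section \<open>Finiteness and extension to maximal bicliques\<close>

lemma finite_vertices: "bipartite_graph G \<Longrightarrow> finite (left G \<union> right G)"
  by (simp add: bipartite_graph_def)

lemma finite_bicliques:
  assumes "bipartite_graph G"
  shows "finite {C. biclique G C \<and> Q C}"
  by (rule finite_subset[of _ "Pow (left G \<union> right G)"])
     (use finite_vertices[OF assms] in \<open>auto simp: biclique_def\<close>)

lemma card_biclique_le:
  assumes "bipartite_graph G" "biclique G C" "two_sided G C"
  shows "card C \<le> max_biclique_size G"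
  unfolding max_biclique_size_def
  using finite_bicliques[OF assms(1)] assms by (intro Max_ge) auto

text \<open>Inserting the witness \<open>v\<close> of extendability supplies the right side.\<close>

lemma extendable_biclique:
  assumes "bipartite_graph G" "S \<subseteq> left G \<union> right G" "linked_set G S" "extendable G S"
    "S \<inter> left G \<noteq> {}"
  obtains C where "S \<subseteq> C" "biclique G C" "two_sided G C"
proof -
  obtain v where v: "v \<in> right G" "\<forall>x\<in>S. linked G x v"
    using assms(4) by (auto simp: extendable_def)
  have "biclique G (insert v S)"
    unfolding biclique_iff[OF assms(1)]
    using v assms(2,3) linked_sym[of G v] by (auto simp: linked_set_def)
  moreover have "two_sided G (insert v S)"
    using v assms(5) by (auto simp: two_sided_def)
  ultimately show thesis using that[of "insert v S"] by blast
qed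

lemma card_extendable_le:
  assumes "bipartite_graph G" "S \<subseteq> left G \<union> right G" "linked_set G S" "extendable G S"
    "S \<inter> left G \<noteq> {}"
  shows "card S \<le> max_biclique_size G"
proof -
  obtain C where C: "S \<subseteq> C" "biclique G C" "two_sided G C"
    using extendable_biclique[OF assms] .
  have "finite C"
    using finite_subset[OF _ finite_vertices[OF assms(1)]] C(2) by (simp add: biclique_def)
  then have "card S \<le> card C" using C(1) by (rule card_mono)
  with card_biclique_le[OF assms(1) C(2,3)] show ?thesis by simp
qed

lemma biclique_extends_to_maximal:
  assumes "bipartite_graph G" "biclique G C" "two_sided G C"
  obtains M where "C \<subseteq> M" "maximal_biclique G M" "two_sided G M"
proof -
  have "finite {D. biclique G D \<and> C \<subseteq> D}" by (rule finite_bicliques[OF assms(1)])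
  from finite_has_maximal2[OF this, of C] assms(2)
  obtain M where M: "biclique G M" "C \<subseteq> M" "\<And>D. biclique G D \<Longrightarrow> C \<subseteq> D \<Longrightarrow> M \<subseteq> D \<Longrightarrow> M = D"
    by auto
  then have "maximal_biclique G M" by (auto simp: maximal_biclique_def)
  moreover have "two_sided G M" using assms(3) M(2) by (auto simp: two_sided_def)
  ultimately show thesis using that M(2) by blast
qed

text \<open>Otherwise \<open>insert x C\<close> would be a larger biclique. The completeness proof
  exploits maximality in this form.\<close>

lemma maximal_biclique_linked:
  assumes "bipartite_graph G" "maximal_biclique G C" "x \<in> left G \<union> right G"
    "\<And>y. y \<in> C \<Longrightarrow> linked G x y"
  shows "x \<in> C"
proof (rule ccontr)
  assume "x \<notin> C"
  have "biclique G (insert x C)"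
    using assms linked_sym[of G _ x]
    by (auto simp: maximal_biclique_def biclique_iff linked_set_def)
  with assms(2) \<open>x \<notin> C\<close> show False by (auto simp: maximal_biclique_def)
qed

text \<open>These lower bounds let additive constants be absorbed into products of the parameters.
  The \<open>2\<close> comes from the endpoints of an edge.\<close>

lemma edge_degrees:
  assumes "bipartite_graph G" "edges G \<noteq> {}"
  shows "max_left_degree G \<ge> 1" "max_degree G \<ge> 1" "max_biclique_size G \<ge> 2"
    "num_maximal_bicliques G \<ge> 1" "left G \<noteq> {}"
proof -
  obtain u v where uv: "(u, v) \<in> edges G" using assms(2) by auto
  then have lr: "u \<in> left G" "v \<in> right G" "v \<in> nbr G u" "u \<noteq> v"
    using assms(1) by (auto simp: bipartite_graph_def nbr_def)
  have fin: "finite (left G)" "finite (left G \<union> right G)"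
    using assms(1) by (auto simp: bipartite_graph_def)
  have pos: "1 \<le> card (nbr G u)"
    using lr(3) finite_nbr(1)[OF assms(1), of u] by (metis One_nat_def Suc_leI card_gt_0_iff empty_iff)
  have "card (nbr G u) \<le> max_left_degree G"
    unfolding max_left_degree_def using fin lr by (intro Max_ge) auto
  with pos show "max_left_degree G \<ge> 1" by simp
  have "card (nbr G u) \<le> max_degree G"
    unfolding max_degree_def using fin lr by (intro Max_ge) auto
  with pos show "max_degree G \<ge> 1" by simp
  have "linked_set G {u, v}"
    using lr linked_left_right[OF assms(1), of u v] linked_sym[of G v u] by (auto simp: linked_set_def)
  then have b: "biclique G {u, v}" using lr by (simp add: biclique_iff[OF assms(1)])
  have s: "two_sided G {u, v}" using lr by (auto simp: two_sided_def)
  show "max_biclique_size G \<ge> 2"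
    using card_biclique_le[OF assms(1) b s] lr(4) by simp
  obtain M where "maximal_biclique G M" "two_sided G M"
    using biclique_extends_to_maximal[OF assms(1) b s] by blast
  moreover have "finite {C. maximal_biclique G C \<and> two_sided G C}"
    using finite_bicliques[OF assms(1)] by (rule rev_finite_subset) (auto simp: maximal_biclique_def)
  ultimately have "num_maximal_bicliques G \<noteq> 0"
    unfolding num_maximal_bicliques_def by (auto simp: card_eq_0_iff)
  then show "num_maximal_bicliques G \<ge> 1" by simp
  show "left G \<noteq> {}" using lr by auto
qed

lemma degree_bounds:
  assumes "bipartite_graph G"
  shows "x \<in> left G \<union> right G \<Longrightarrow> card (nbr G x) \<le> max_degree G"
    "u \<in> left G \<Longrightarrow> card (nbr G u) \<le> max_left_degree G"
    "u \<in> left G \<Longrightarrow> card (nbr2 G u) \<le> max_left_degree2 G"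
    "u \<in> left G \<Longrightarrow> card (nbrP G u) \<le> max_left_degree G + max_left_degree2 G"
proof -
  show "x \<in> left G \<union> right G \<Longrightarrow> card (nbr G x) \<le> max_degree G"
    unfolding max_degree_def using finite_vertices[OF assms] by (intro Max_ge) auto
  have fin: "finite (left G)" using assms by (simp add: bipartite_graph_def)
  show l: "card (nbr G u) \<le> max_left_degree G" if "u \<in> left G"
    unfolding max_left_degree_def using that fin by (intro Max_ge) auto
  show l2: "card (nbr2 G u) \<le> max_left_degree2 G" if "u \<in> left G"
    unfolding max_left_degree2_def using that fin by (intro Max_ge) auto
  show "card (nbrP G u) \<le> max_left_degree G + max_left_degree2 G" if "u \<in> left G"
    using card_Un_le[of "nbr G u" "nbr2 G u"] l[OF that] l2[OF that] by (simp add: nbrP_def)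
qed


section \<open>Running times of the elementary loops\<close>

lemma foreach_finite: "(s', t) \<in> foreach A f s \<Longrightarrow> finite A"
  by (auto simp: foreach_def prog_iff)

text \<open>The leading \<open>1\<close> pays for entering the loop; the step count carried by
  \<open>foreach_invariant\<close> starts after that.\<close>

lemma foreach_cost_le:
  assumes "(s', t) \<in> foreach A f s" "\<And>x r r' b. x \<in> A \<Longrightarrow> (r', b) \<in> f x r \<Longrightarrow> b \<le> c"
  shows "t \<le> 1 + card A * (1 + c)"
proof -
  have fin: "finite A" using foreach_finite[OF assms(1)] .
  have "t \<ge> 1 \<and> t - 1 \<le> card A * (1 + c)"
    using assms(1)
  proof (rule foreach_invariant[where I = "\<lambda>C _ a. a \<le> card C * (1 + c)"])
    fix C x r r' a b
    assume *: "C \<subseteq> A" "x \<in> A - C" "a \<le> card C * (1 + c)" "(r', b) \<in> f x r"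
    have "b \<le> c" using assms(2)[of x r' b r] * by blast
    moreover have "card (insert x C) = Suc (card C)"
      using * fin by (simp add: finite_subset)
    ultimately show "Suc (a + b) \<le> card (insert x C) * (1 + c)" using *(3) by simp
  qed simp
  then show ?thesis by linarith
qed

lemma filter_set_cost: "(B, t) \<in> filter_set Q A \<Longrightarrow> t \<le> 1 + card A"
  unfolding filter_set_def by (drule foreach_cost_le[where c = 0]) (auto simp: prog_iff)

lemma copy_set_cost: "(B, t) \<in> copy_set A \<Longrightarrow> t \<le> 1 + card A"
  unfolding copy_set_def by (rule filter_set_cost)

lemma pivot_size_cost: "(k, t) \<in> pivot_size G P p \<Longrightarrow> t \<le> 1 + card (nbr G p)"
  unfolding pivot_size_def
  by (auto simp: prog_iff dest!: foreach_cost_le[where c = 0] split: if_splits)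

text \<open>The neighbours of every possible pivot are scanned; this is where the cost of a call
  acquires the factor \<open>max_degree G\<close>.\<close>

lemma choose_pivot_cost:
  assumes "bipartite_graph G" "P \<union> X \<subseteq> left G \<union> right G" "(best, t) \<in> choose_pivot G P X"
  shows "t \<le> 1 + card (P \<union> X) * (2 + max_degree G)"
proof -
  have "t \<le> 1 + card (P \<union> X) * (1 + (1 + max_degree G))"
    using assms(3) unfolding choose_pivot_def
  proof (rule foreach_cost_le)
    fix x r r' b
    assume "x \<in> P \<union> X" and "(r', b) \<in> (do {
         k \<leftarrow> pivot_size G P x;
         ret (case r of None \<Rightarrow> Some (x, k)
            | Some (p', k') \<Rightarrow> if k < k' then Some (x, k) else Some (p', k'))
       })"
    moreover from this obtain k where "(k, b) \<in> pivot_size G P x" by (auto simp: prog_iff)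
    ultimately show "b \<le> 1 + max_degree G"
      using pivot_size_cost[of k b G P x] degree_bounds(1)[OF assms(1), of x] assms(2) by auto
  qed
  then show ?thesis by simp
qed

lemma build_pivot_set_cost:
  assumes "finite P" "(Q, t) \<in> build_pivot_set G P p"
  shows "t \<le> 1 + card P"
proof -
  obtain Q' where "(Q', t) \<in> filter_set (\<lambda>y. y \<notin> nbr G p) (opposite G p P)"
    using assms(2) by (auto simp: build_pivot_set_def prog_iff)
  then have "t \<le> 1 + card (opposite G p P)" by (rule filter_set_cost)
  also have "card (opposite G p P) \<le> card P"
    using assms(1) by (intro card_mono) (auto simp: opposite_def)
  finally show ?thesis by simp
qed


section \<open>Induction over call trees\<close>

definition candidates :: "'a bigraph \<Rightarrow> 'a \<Rightarrow> 'a set \<Rightarrow> 'a set" where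
  "candidates G u R = {y \<in> insert u (nbrP G u). \<forall>x\<in>R. linked G x y}"

text \<open>\<open>R \<subseteq> candidates G u R\<close> makes \<open>R\<close> a clique. The
  equation says that every vertex that could enlarge \<open>R\<close> is recorded, either in
  \<open>P\<close> or in \<open>X\<close>.\<close>

definition call_inv :: "'a bigraph \<Rightarrow> 'a \<Rightarrow> 'a set \<Rightarrow> 'a set \<Rightarrow> 'a set \<Rightarrow> bool" where
  "call_inv G u R P X \<longleftrightarrow> u \<in> left G \<and> u \<in> R \<and> R \<subseteq> candidates G u R \<and>
     P \<union> X = candidates G u R - R \<and> P \<inter> X = {}"

lemma nbrP_sides: "bipartite_graph G \<Longrightarrow> u \<in> left G \<Longrightarrow> nbrP G u \<subseteq> left G \<union> right G"
  using nbr_sides(1,3)[of G u] by (auto simp: nbrP_def)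

lemma call_invD:
  assumes "bipartite_graph G" "call_inv G u R P X"
  shows "u \<in> R" "u \<in> left G" "P \<inter> X = {}" "R \<inter> (P \<union> X) = {}" "linked_set G R"
    "\<And>x y. x \<in> R \<Longrightarrow> y \<in> P \<union> X \<Longrightarrow> linked G x y"
    "R \<union> P \<union> X \<subseteq> insert u (nbrP G u)" "R \<union> P \<union> X \<subseteq> left G \<union> right G"
    "finite R" "finite P" "finite X"
proof -
  show "u \<in> R" and u: "u \<in> left G" and "P \<inter> X = {}" "R \<inter> (P \<union> X) = {}" "linked_set G R"
    "\<And>x y. x \<in> R \<Longrightarrow> y \<in> P \<union> X \<Longrightarrow> linked G x y"
    using assms(2) by (auto simp: call_inv_def candidates_def linked_set_def)
  show sub: "R \<union> P \<union> X \<subseteq> insert u (nbrP G u)"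
    using assms(2) by (auto simp: call_inv_def candidates_def)
  then show sub': "R \<union> P \<union> X \<subseteq> left G \<union> right G"
    using nbrP_sides[OF assms(1) u] u by blast
  have "finite (R \<union> P \<union> X)" by (rule finite_subset[OF sub' finite_vertices[OF assms(1)]])
  then show "finite R" "finite P" "finite X" by auto
qed

text \<open>All sets of a call live around the root vertex \<open>u\<close>, which bounds them by
  the two left degree parameters together.\<close>

lemma call_inv_cards:
  assumes "bipartite_graph G" "call_inv G u R P X"
  shows "card (R \<union> P) \<le> 1 + card (nbrP G u)" "card R \<le> 1 + card (nbrP G u)"
    "card P \<le> card (nbrP G u)" "card X \<le> card (nbrP G u)" "card (P \<union> X) \<le> card (nbrP G u)"
proof -
  note I = call_invD[OF assms]
  have fin: "finite (nbrP G u)" by (rule finite_nbr(3)[OF assms(1)])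
  have 1: "card S \<le> 1 + card (nbrP G u)" if "S \<subseteq> insert u (nbrP G u)" for S
    using card_mono[OF _ that] fin by (simp add: card_insert_if split: if_splits)
  show "card (R \<union> P) \<le> 1 + card (nbrP G u)" "card R \<le> 1 + card (nbrP G u)"
    using I(7) by (blast intro: 1)+
  have "P \<union> X \<subseteq> nbrP G u" using I(1,4,7) by auto
  then show "card P \<le> card (nbrP G u)" "card X \<le> card (nbrP G u)" "card (P \<union> X) \<le> card (nbrP G u)"
    by (auto intro!: card_mono fin)
qed

text \<open>Neighbours of \<open>u\<close> are adjacent to it and second neighbours are on its side,
  so all of \<open>nbrP G u\<close> is linked to \<open>u\<close> and \<open>D\<close> merely splits
  the candidates.\<close>

lemma call_inv_root:
  assumes "bipartite_graph G" "u \<in> left G"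
  shows "call_inv G u {u} (nbrP G u - D) (nbrP G u \<inter> D)"
proof -
  have "u \<notin> nbrP G u"
    using nbr_sides(1)[OF assms] assms by (auto simp: nbrP_def nbr2_def bipartite_graph_def)
  moreover have "linked G u y" if "y \<in> nbrP G u" for y
    using that nbr_sides(3)[OF assms] assms(2) by (auto simp: nbrP_def linked_def same_side_def)
  ultimately show ?thesis
    using assms(2) by (auto simp: call_inv_def candidates_def)
qed

text \<open>Adding \<open>x\<close> restricts the candidates to those linked to \<open>x\<close>,
  the same restriction that is applied to \<open>P\<close> and \<open>X\<close>.\<close>

lemma call_inv_child:
  assumes "bipartite_graph G" "call_inv G u R P X" "x \<in> P"
  shows "call_inv G u (insert x R) {y \<in> P. y \<noteq> x \<and> linked G x y} {y \<in> X. linked G x y}"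
proof -
  have "candidates G u (insert x R) = {y \<in> candidates G u R. linked G x y}"
    by (auto simp: candidates_def)
  moreover have "x \<in> candidates G u R" using assms(2,3) by (auto simp: call_inv_def)
  moreover have "linked G x y" if "y \<in> R" for y
    using call_invD(6)[OF assms(1,2) that, of x] assms(3) linked_sym[of G x y] by simp
  ultimately show ?thesis
    using assms(2,3) unfolding call_inv_def by auto
qed

lemma call_inv_shift: "call_inv G u R P X \<Longrightarrow> x \<in> P \<Longrightarrow> call_inv G u R (P - {x}) (insert x X)"
  unfolding call_inv_def by auto

text \<open>This form treats both sides alike. Since \<open>p\<close> is linked to itself, it has to
  be added by \<open>y = p\<close>.\<close>

lemma pivot_set_eq:
  assumes "bipartite_graph G" "P \<subseteq> left G \<union> right G" "p \<in> left G \<union> right G"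
  shows "pivot_set G P p = {y \<in> P. \<not> linked G p y \<or> y = p}"
  using assms
  by (auto simp: pivot_set_def opposite_def linked_def same_side_def bipartite_graph_def)

text \<open>A right vertex linked to all of \<open>R\<close> is adjacent to \<open>u\<close>, hence
  a candidate. If both tests of a call fail, \<open>P \<union> X\<close> contains a right vertex, so
  calls that branch are extendable.\<close>

lemma extendable_iff:
  assumes "bipartite_graph G" "call_inv G u R P X"
  shows "extendable G R \<longleftrightarrow> (R \<union> P \<union> X) \<inter> right G \<noteq> {}"
proof
  assume "extendable G R"
  then obtain v where v: "v \<in> right G" "\<forall>x\<in>R. linked G x v" by (auto simp: extendable_def)
  note I = call_invD(1,2)[OF assms]
  from v I have "v \<in> nbr G u" using linked_left_right[OF assms(1), of u v] by blast
  with v have "v \<in> candidates G u R" by (auto simp: candidates_def nbrP_def)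
  with assms(2) v show "(R \<union> P \<union> X) \<inter> right G \<noteq> {}" by (auto simp: call_inv_def)
next
  assume "(R \<union> P \<union> X) \<inter> right G \<noteq> {}"
  then show "extendable G R"
    using call_invD(5,6)[OF assms] unfolding extendable_def linked_set_def by blast
qed

text \<open>Serves completeness, leaf count and running time alike: \<Phi> is about calls, \<Psi>
  about loops. Program outcomes are replaced by the sets they compute and elementary costs by
  bounds, so each use argues about sets and numbers only.\<close>

lemma bkmbe_induct [consumes 3, case_names report prune branch Nil Cons]:
  assumes G: "bipartite_graph G"
    and run: "bkmbe G R P X T t" and inv: "call_inv G u R P X"
    and report: "\<And>R P X t. \<lbrakk>call_inv G u R P X; no_extension G P X; t \<le> 2 + card (R \<union> P)\<rbrakk>
      \<Longrightarrow> \<Phi> R P X (Call (Some (R \<union> P)) []) t"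
    and prune: "\<And>R P X. \<lbrakk>call_inv G u R P X; \<not> no_extension G P X; not_maximal G P X\<rbrakk>
      \<Longrightarrow> \<Phi> R P X (Call None []) 1"
    and branch: "\<And>R P X p xs Ts s t. \<lbrakk>call_inv G u R P X; \<not> no_extension G P X; \<not> not_maximal G P X;
        p \<in> P \<union> X; \<And>p'. p' \<in> P \<union> X \<Longrightarrow> card (pivot_set G P p) \<le> card (pivot_set G P p');
        distinct xs; set xs = pivot_set G P p; \<Psi> R P X xs Ts s;
        t \<le> 3 + card (P \<union> X) * (2 + max_degree G) + card P + s\<rbrakk>
      \<Longrightarrow> \<Phi> R P X (Call None Ts) t"
    and Nil: "\<And>R P X. call_inv G u R P X \<Longrightarrow> \<Psi> R P X [] [] 1"
    and Cons: "\<And>R P X x xs T Ts t t' s. \<lbrakk>call_inv G u R P X; x \<in> P; set xs \<subseteq> P - {x}; distinct xs;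
        call_inv G u (insert x R) {y \<in> P. y \<noteq> x \<and> linked G x y} {y \<in> X. linked G x y};
        \<Phi> (insert x R) {y \<in> P. y \<noteq> x \<and> linked G x y} {y \<in> X. linked G x y} T t;
        \<Psi> R (P - {x}) (insert x X) xs Ts t';
        s \<le> 4 + card R + card P + card X + t + t'\<rbrakk>
      \<Longrightarrow> \<Psi> R P X (x # xs) (T # Ts) s"
  shows "\<Phi> R P X T t"
proof -
  \<comment> \<open>Each element of the list is moved from \<open>P'\<close> to \<open>X'\<close>
    after its call; distinctness keeps the later ones in \<open>P'\<close>.\<close>
  have "(bkmbe G R P X T t \<longrightarrow> call_inv G u R P X \<longrightarrow> \<Phi> R P X T t) \<and>
    (bkmbe_loop G R' P' X' xs Ts t' \<longrightarrow> call_inv G u R' P' X' \<longrightarrow> distinct xs \<longrightarrow> set xs \<subseteq> P' \<longrightarrow>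
       \<Psi> R' P' X' xs Ts t')" for R' P' X' xs Ts t'
  proof (induction rule: bkmbe_bkmbe_loop.induct)
    case (bkmbe_output P X C t R)
    show ?case
    proof
      assume i: "call_inv G u R P X"
      have "C = R \<union> P" "Suc t \<le> 2 + card (R \<union> P)"
        using copy_set_outcome[OF bkmbe_output(2)] copy_set_cost[OF bkmbe_output(2)] by simp_all
      with report[OF i bkmbe_output(1)] show "\<Phi> R P X (Call (Some C) []) (Suc t)" by simp
    qed
  next
    case (bkmbe_prune P X R)
    then show ?case using prune by blast
  next
    case (bkmbe_branch P X p k t1 Q t2 xs R Ts t3)
    show ?case
    proof
      assume i: "call_inv G u R P X"
      note I = call_invD[OF G i]
      have sub: "P \<subseteq> left G \<union> right G" "X \<subseteq> left G \<union> right G" "P \<union> X \<subseteq> left G \<union> right G"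
        using I(8) by auto
      have ne: "P \<union> X \<noteq> {}" using bkmbe_branch(1) by (auto simp: no_extension_def)
      from choose_pivot_outcome[OF G sub(1,2) bkmbe_branch(3) ne]
      have p: "p \<in> P \<union> X" "\<And>p'. p' \<in> P \<union> X \<Longrightarrow> card (pivot_set G P p) \<le> card (pivot_set G P p')"
        by auto
      have Q: "set xs = pivot_set G P p"
        using bkmbe_branch(8) build_pivot_set_outcome[OF bkmbe_branch(4)] by simp
      also have "\<dots> \<subseteq> P" by (auto simp: pivot_set_def opposite_def)
      finally have "\<Psi> R P X xs Ts t3" using bkmbe_branch(6,7) i by blast
      \<comment> \<open>The \<open>3\<close> counts the call itself and the entries into the loops
        for the pivot and for \<open>Q\<close>.\<close>
      moreover have "Suc (t1 + t2 + t3) \<le> 3 + card (P \<union> X) * (2 + max_degree G) + card P + t3"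
        using choose_pivot_cost[OF G sub(3) bkmbe_branch(3)]
          build_pivot_set_cost[OF I(10) bkmbe_branch(4)] by linarith
      ultimately show "\<Phi> R P X (Call None Ts) (Suc (t1 + t2 + t3))"
        using branch[OF i bkmbe_branch(1,2) p bkmbe_branch(7) Q] by blast
    qed
  next
    case (bkmbe_loop_Nil R P X)
    then show ?case using Nil by blast
  next
    case (bkmbe_loop_Cons R' s1 R P' s2 x P X' s3 X T t xs Ts t')
    show ?case
    proof (intro impI)
      assume i: "call_inv G u R P X" and xs: "distinct (x # xs)" "set (x # xs) \<subseteq> P"
      have eq: "R' = R" "P' = {y \<in> P. y \<noteq> x \<and> linked G x y}" "X' = {y \<in> X. linked G x y}"
        using copy_set_outcome[OF bkmbe_loop_Cons(1)]
          filter_set_outcome[OF bkmbe_loop_Cons(2)[unfolded child_P_def]]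
          filter_set_outcome[OF bkmbe_loop_Cons(3)[unfolded child_X_def]]
        by (auto simp: linked_def)
      have le: "s1 \<le> 1 + card R" "s2 \<le> 1 + card P" "s3 \<le> 1 + card X"
        using copy_set_cost[OF bkmbe_loop_Cons(1)]
          filter_set_cost[OF bkmbe_loop_Cons(2)[unfolded child_P_def]]
          filter_set_cost[OF bkmbe_loop_Cons(3)[unfolded child_X_def]] .
      have c: "call_inv G u (insert x R) {y \<in> P. y \<noteq> x \<and> linked G x y} {y \<in> X. linked G x y}"
        using call_inv_child[OF G i, of x] xs by simp
      have x: "x \<in> P" "set xs \<subseteq> P - {x}" "distinct xs" using xs by auto
      have call: "\<Phi> (insert x R) {y \<in> P. y \<noteq> x \<and> linked G x y} {y \<in> X. linked G x y} T t"
        using bkmbe_loop_Cons(5) eq c by simp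
      have loop: "\<Psi> R (P - {x}) (insert x X) xs Ts t'"
        using bkmbe_loop_Cons(7) call_inv_shift[OF i x(1)] x by blast
      \<comment> \<open>The \<open>4\<close> counts the iteration and the entries into the three
        filling loops.\<close>
      have "Suc (s1 + s2 + s3 + t + t') \<le> 4 + card R + card P + card X + t + t'"
        using le by linarith
      then show "\<Psi> R P X (x # xs) (T # Ts) (Suc (s1 + s2 + s3 + t + t'))"
        by (rule Cons[OF i x c call loop])
    qed
  qed
  then show ?thesis using run inv by blast
qed

section \<open>Leaves of a call tree\<close>

lemma leaves_ge_1: "1 \<le> leaves T"
proof (induction T rule: leaves.induct)
  case (1 C Ts)
  show ?case
  proof (cases Ts)
    case (Cons T' Ts')
    then show ?thesis using 1[of T'] by simp
  qed simp
qed

lemma length_le_sum_leaves: "length Ts \<le> (\<Sum>T\<leftarrow>Ts. leaves T)"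
proof (induction Ts)
  case (Cons T Ts)
  with leaves_ge_1[of T] show ?case by simp
qed simp


section \<open>Every maximal biclique is reported\<close>

text \<open>Outputs are read off at calls without children only, so each leaf accounts for at most
  one set.\<close>

fun reports :: "'a call_tree \<Rightarrow> 'a set set" where
  "reports (Call C Ts) = (if Ts = [] then set_option C else (\<Union>T\<in>set Ts. reports T))"

lemma reports_card:
  "finite (reports T) \<and> card (reports T) \<le> leaves T"
proof (induction T rule: reports.induct)
  case (1 C Ts)
  show ?case
  proof (cases "Ts = []")
    case True
    then show ?thesis by (cases C) auto
  next
    case False
    have "finite (\<Union>T\<in>set Us. reports T) \<and>
        card (\<Union>T\<in>set Us. reports T) \<le> (\<Sum>T\<leftarrow>Us. leaves T)" if "set Us \<subseteq> set Ts" for Us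
      using that
    proof (induction Us)
      case (Cons U Us)
      then have "finite (reports U)" "card (reports U) \<le> leaves U"
        using "1.IH"[OF False, of U] by auto
      with Cons card_Un_le[of "reports U" "\<Union>T\<in>set Us. reports T"] show ?case by auto
    qed simp
    with False show ?thesis by auto
  qed
qed

text \<open>\<open>R \<subseteq> C\<close> and \<open>C \<subseteq> R \<union> P\<close> say that
  \<open>C\<close> can still be reached. In the loop, the first list element in \<open>C\<close>
  leads to a child that can reach \<open>C\<close>; removing earlier elements from \<open>P\<close>
  does no harm.\<close>

lemma bkmbe_reports:
  assumes G: "bipartite_graph G" and "bkmbe G R P X T t" "call_inv G u R P X"
    and C: "maximal_biclique G C" and "R \<subseteq> C" "C \<subseteq> R \<union> P"
  shows "C \<in> reports T"
proof -
  have CC: "linked_set G C" "C \<subseteq> left G \<union> right G"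
    using C G by (auto simp: maximal_biclique_def biclique_iff)
  have "R \<subseteq> C \<longrightarrow> C \<subseteq> R \<union> P \<longrightarrow> C \<in> reports T"
    using assms(1-3)
  proof (induction rule: bkmbe_induct[where
        \<Psi> = "\<lambda>R P X xs Ts t. R \<subseteq> C \<longrightarrow> C \<subseteq> R \<union> P \<longrightarrow> C \<inter> set xs \<noteq> {} \<longrightarrow>
          (\<exists>T\<in>set Ts. C \<in> reports T)"])
    case (report R P X t)
    note I = call_invD[OF G report(1)]
    show ?case
    proof (intro impI)
      assume "R \<subseteq> C" "C \<subseteq> R \<union> P"
      \<comment> \<open>Here \<open>P\<close> lies on one side, so \<open>R \<union> P\<close> is a
        clique and maximality gives \<open>C = R \<union> P\<close>.\<close>
      have P1: "linked G x y" if "x \<in> P" "y \<in> P" for x y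
        using report(2) that I(8) linked_same_side(1)[of x G y] linked_same_side(2)[OF G, of x y]
        by (auto simp: no_extension_def)
      have "x \<in> C" if x: "x \<in> P" for x
      proof (rule maximal_biclique_linked[OF G C])
        show "x \<in> left G \<union> right G" using x I(8) by auto
        fix y assume "y \<in> C"
        then consider "y \<in> R" | "y \<in> P" using \<open>C \<subseteq> R \<union> P\<close> by auto
        then show "linked G x y"
          using I(6)[of y x] P1 x linked_sym[of G x y] by cases auto
      qed
      with \<open>R \<subseteq> C\<close> \<open>C \<subseteq> R \<union> P\<close> have "C = R \<union> P" by blast
      then show "C \<in> reports (Call (Some (R \<union> P)) [])" by simp
    qed
  next
    case (prune R P X)
    note I = call_invD[OF G prune(1)]
    show ?case
    proof (intro impI)
      assume sub: "R \<subseteq> C" "C \<subseteq> R \<union> P"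
      \<comment> \<open>Some \<open>x\<close> in \<open>X\<close> is on the same side as all of
        \<open>P\<close>. Maximality would put it into \<open>C\<close>, which is disjoint from
        \<open>X\<close>.\<close>
      from prune(3) obtain x where x: "x \<in> X" "\<And>y. y \<in> P \<Longrightarrow> linked G x y"
      proof (unfold not_maximal_def, elim disjE conjE)
        assume e: "P \<inter> left G = {}" "X \<inter> right G \<noteq> {}"
        then obtain x where "x \<in> X" "x \<in> right G" by auto
        with e I(8) show thesis
          by (intro that[of x] linked_same_side(2)[OF G]) auto
      next
        assume e: "P \<inter> right G = {}" "X \<inter> left G \<noteq> {}"
        then obtain x where "x \<in> X" "x \<in> left G" by auto
        with e I(8) show thesis
          by (intro that[of x] linked_same_side(1)) auto
      qed
      have "x \<in> C"
      proof (rule maximal_biclique_linked[OF G C])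
        show "x \<in> left G \<union> right G" using x I(8) by auto
        fix y assume "y \<in> C"
        then show "linked G x y"
          using sub x I(6)[of y x] linked_sym[of G x y] by auto
      qed
      with sub x I(3,4) show "C \<in> reports (Call None [])" by blast
    qed
  next
    case (branch R P X p xs Ts s t)
    note I = call_invD[OF G branch(1)]
    have sub: "P \<subseteq> left G \<union> right G" "p \<in> left G \<union> right G" using I(8) branch(4) by auto
    have Q: "set xs = {y \<in> P. \<not> linked G p y \<or> y = p}"
      using branch(7) pivot_set_eq[OF G sub] by simp
    show ?case
    proof (intro impI)
      assume RC: "R \<subseteq> C" "C \<subseteq> R \<union> P"
      \<comment> \<open>If \<open>C\<close> missed \<open>Q\<close>, it would be linked to the pivot
        throughout and hence contain it. Then the pivot would be in \<open>P\<close> and so in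
        \<open>Q\<close>.\<close>
      have "C \<inter> set xs \<noteq> {}"
      proof
        assume e: "C \<inter> set xs = {}"
        have "p \<in> C"
        proof (rule maximal_biclique_linked[OF G C sub(2)])
          fix y assume "y \<in> C"
          then show "linked G p y"
            using e Q RC I(6)[of y p] branch(4) linked_sym[of G p y] by blast
        qed
        with e Q RC branch(4) I(3,4) show False by auto
      qed
      with branch(8) RC obtain T where "T \<in> set Ts" "C \<in> reports T" by blast
      then show "C \<in> reports (Call None Ts)" by auto
    qed
  next
    case (Cons R P X x xs T Ts t t' s)
    show ?case
    proof (cases "x \<in> C")
      case True
      then have "C \<subseteq> insert x R \<union> {y \<in> P. y \<noteq> x \<and> linked G x y}" if "C \<subseteq> R \<union> P"
        using CC(1) that by (auto simp: linked_set_def)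
      with True Cons(6,8) show ?thesis by auto
    next
      case False
      with Cons(6,8) show ?thesis by auto
    qed
  qed auto
  with assms show ?thesis by blast
qed


section \<open>The number of leaves of a call tree\<close>

definition extendable_between :: "'a bigraph \<Rightarrow> 'a set \<Rightarrow> 'a set \<Rightarrow> 'a set set" where
  "extendable_between G R P = {S. R \<subseteq> S \<and> S \<subseteq> R \<union> P \<and> linked_set G S \<and> extendable G S}"

lemma finite_extendable_between: "finite R \<Longrightarrow> finite P \<Longrightarrow> finite (extendable_between G R P)"
  by (rule finite_subset[of _ "Pow (R \<union> P)"]) (auto simp: extendable_between_def)

text \<open>
  The children \<open>R \<union> {x}\<close> that are not extendable are the leaves not counted by a biclique.  The
  sets \<open>R \<union> S\<close> with \<open>S \<subseteq> P\<^sub>V - Q\<close> belong to no child, so they can be counted instead, and the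
  minimality of \<open>Q\<close> makes them numerous enough.
\<close>
lemma card_not_extendable_children:
  assumes G: "bipartite_graph G" and inv: "call_inv G u R P X" and ext: "extendable G R"
    and p: "p \<in> P \<union> X"
    and min: "\<And>p'. p' \<in> P \<union> X \<Longrightarrow> card (pivot_set G P p) \<le> card (pivot_set G P p')"
  shows "card {x \<in> pivot_set G P p. \<not> extendable G (insert x R)}
       \<le> card {S \<in> extendable_between G R P. S \<inter> pivot_set G P p = {}}"
proof -
  note I = call_invD[OF G inv]
  define Q where "Q = pivot_set G P p"
  define B where "B = {x \<in> Q. \<not> extendable G (insert x R)}"
  have sub: "P \<subseteq> left G \<union> right G" "p \<in> left G \<union> right G" using I(8) p by auto
  have Q: "Q = {y \<in> P. \<not> linked G p y \<or> y = p}"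
    unfolding Q_def by (rule pivot_set_eq[OF G sub])
  have finQ: "finite Q" using I(10) Q by simp
  have disj: "left G \<inter> right G = {}" using G by (simp add: bipartite_graph_def)
  show ?thesis
  proof (cases "B = {}")
    case False
    then obtain b where b: "b \<in> Q" "\<not> extendable G (insert b R)" by (auto simp: B_def)
    \<comment> \<open>A right vertex \<open>x\<close> is itself a witness that
      \<open>insert x R\<close> is extendable.\<close>
    have BL: "x \<in> left G" if "x \<in> B" for x
    proof (rule ccontr)
      assume "x \<notin> left G"
      with that Q sub have x: "x \<in> right G" "x \<in> P" by (auto simp: B_def)
      then have "extendable G (insert x R)"
        using I(6)[of _ x] by (auto simp: extendable_def intro!: bexI[of _ x])
      with that show False by (simp add: B_def)
    qed
    have RV: "R \<inter> right G = {}"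
    proof (rule ccontr)
      assume "R \<inter> right G \<noteq> {}"
      then obtain v where "v \<in> right G" "v \<in> R" by auto
      moreover have "linked G b v"
        using I(6)[of v b] \<open>v \<in> R\<close> b(1) Q linked_sym[of G b v] by auto
      ultimately have "extendable G (insert b R)"
        using I(5) by (auto simp: extendable_def linked_set_def intro!: bexI[of _ v])
      with b(2) show False by simp
    qed
    have bB: "b \<in> B" "b \<in> P" "b \<in> left G" using b BL Q by (auto simp: B_def)
    \<comment> \<open>Every subset of \<open>W\<close> together with \<open>R\<close> is an
      extendable clique avoiding \<open>Q\<close>, which gives \<open>2 ^ card W\<close> free
      sets.\<close>
    define W where "W = P \<inter> right G - Q"
    have finW: "finite W" using I(10) by (simp add: W_def)
    have "(\<lambda>S. R \<union> S) ` Pow W \<subseteq> {S \<in> extendable_between G R P. S \<inter> Q = {}}"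
    proof (rule image_subsetI)
      fix S assume S: "S \<in> Pow W"
      then have S': "S \<subseteq> P" "S \<subseteq> right G" "S \<inter> Q = {}" by (auto simp: W_def)
      have "linked_set G (R \<union> S)"
        unfolding linked_set_def
      proof (intro ballI)
        fix x y assume "x \<in> R \<union> S" "y \<in> R \<union> S"
        then show "linked G x y"
          using I(5) I(6)[of x y] I(6)[of y x] S' linked_sym[of G x y]
            linked_same_side(2)[OF G, of x y] by (auto simp: linked_set_def)
      qed
      moreover from ext obtain v where v: "v \<in> right G" "\<forall>x\<in>R. linked G x v"
        by (auto simp: extendable_def)
      then have "extendable G (R \<union> S)"
        using S' linked_same_side(2)[OF G, of _ v] by (auto simp: extendable_def intro!: bexI[of _ v])
      moreover have "R \<inter> Q = {}" using I(4) Q by auto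
      ultimately show "R \<union> S \<in> {S \<in> extendable_between G R P. S \<inter> Q = {}}"
        using S' by (auto simp: extendable_between_def)
    qed
    then have "card ((\<lambda>S. R \<union> S) ` Pow W) \<le> card {S \<in> extendable_between G R P. S \<inter> Q = {}}"
      using finite_extendable_between[OF I(9,10)] by (intro card_mono) auto
    moreover have "inj_on (\<lambda>S. R \<union> S) (Pow W)"
      using I(4) by (intro inj_onI) (auto simp: W_def)
    ultimately have slots: "2 ^ card W \<le> card {S \<in> extendable_between G R P. S \<inter> Q = {}}"
      using finW by (simp add: card_image card_Pow)
    \<comment> \<open>This suffices because \<open>Suc n \<le> 2 ^ n\<close>.\<close>
    have "card B \<le> Suc (card W)"
    proof (cases "p \<in> left G")
      case True
      \<comment> \<open>A left pivot is linked to all left vertices, so \<open>p\<close> is the only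
        left vertex that \<open>Q\<close> can contain.\<close>
      have "B \<subseteq> {p}" using BL True Q linked_same_side(1)[of p G] by (auto simp: B_def)
      then show ?thesis using card_mono[of "{p}" B] by simp
    next
      case False
      with sub have pr: "p \<in> right G" by auto
      have WQ: "W = P \<inter> right G - {p}"
        using Q linked_same_side(2)[OF G pr] by (auto simp: W_def)
      \<comment> \<open>Compare the pivot with \<open>b\<close>: as a left vertex, \<open>b\<close>
        would leave only itself and right vertices of \<open>P\<close> in its pivot set.\<close>
      have "pivot_set G P b \<subseteq> insert b (P \<inter> right G)"
        using pivot_set_eq[OF G sub(1), of b] sub(1) bB linked_same_side(1)[OF bB(3)] by auto
      then have "card (pivot_set G P b) \<le> card (insert b (P \<inter> right G))"
        using I(10) by (intro card_mono) auto
      then have "card (pivot_set G P b) \<le> Suc (card (P \<inter> right G))"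
        using I(10) by (simp add: card_insert_if split: if_splits)
      with min[of b] bB have cQ: "card Q \<le> Suc (card (P \<inter> right G))" by (auto simp: Q_def)
      show ?thesis
      proof (cases "p \<in> P")
        case True
        then have "p \<in> Q" using Q by simp
        \<comment> \<open>The right vertex \<open>p\<close> is in \<open>Q\<close> but not in
          \<open>B\<close>. This saves one and makes up for \<open>W\<close> lacking
          \<open>p\<close>.\<close>
        moreover have "B \<subseteq> Q - {p}" using BL pr disj by (auto simp: B_def)
        then have "card B \<le> card (Q - {p})" using finQ by (intro card_mono) auto
        moreover have "card (P \<inter> right G) = Suc (card W)"
          unfolding WQ using True pr I(10) by (intro card.remove) auto
        ultimately show ?thesis using cQ finQ by simp
      next
        case False
        have "card B \<le> card Q" using finQ by (intro card_mono) (auto simp: B_def)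
        with cQ False show ?thesis by (simp add: WQ)
      qed
    qed
    also have "\<dots> \<le> 2 ^ card W" using less_exp[of "card W"] by (simp only: Suc_le_eq)
    finally show ?thesis using slots by (simp add: B_def Q_def)
  qed (simp flip: Q_def B_def)
qed

text \<open>A set meeting the list is charged to the child of its first list element. A child that
  is not extendable has a single leaf, counted by the second summand of \<Psi>; at a branching call
  these leaves are exchanged for sets that avoid \<open>Q\<close>.\<close>

lemma bkmbe_leaves_le:
  assumes G: "bipartite_graph G" and "bkmbe G R P X T t" "call_inv G u R P X"
  shows "leaves T \<le> (if extendable G R then card (extendable_between G R P) else 1)"
  using assms
proof (induction rule: bkmbe_induct[where
      \<Psi> = "\<lambda>R P X xs Ts t. extendable G R \<longrightarrow> (\<Sum>T\<leftarrow>Ts. leaves T) \<le>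
        card {S \<in> extendable_between G R P. S \<inter> set xs \<noteq> {}} +
        card {x \<in> set xs. \<not> extendable G (insert x R)}"])
  \<comment> \<open>\<open>R\<close> itself is counted, which covers calls without children.\<close>
  have self: "1 \<le> card (extendable_between G R P)"
    if "call_inv G u R P X" "extendable G R" for R P X
  proof -
    have "R \<in> extendable_between G R P"
      using that call_invD(5)[OF G that(1)] by (auto simp: extendable_between_def)
    moreover have "finite (extendable_between G R P)"
      using finite_extendable_between call_invD(9,10)[OF G that(1)] .
    ultimately show ?thesis by (metis One_nat_def Suc_leI card_gt_0_iff empty_iff)
  qed
  {
    case (report R P X t)
    then show ?case using self[of R P X] by simp
  next
    case (prune R P X)
    then show ?case using self[of R P X] by simp
  next
    case (branch R P X p xs Ts s t)
    note I = call_invD[OF G branch(1)]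
    have ext: "extendable G R"
      unfolding extendable_iff[OF G branch(1)]
      using branch(2,3) I(8) by (auto simp: no_extension_def not_maximal_def)
    define F where "F = extendable_between G R P"
    have finF: "finite F" unfolding F_def by (rule finite_extendable_between[OF I(9,10)])
    have "(\<Sum>T\<leftarrow>Ts. leaves T) \<le> card {S \<in> F. S \<inter> set xs \<noteq> {}} + card {S \<in> F. S \<inter> set xs = {}}"
      using branch(8) ext card_not_extendable_children[OF G branch(1) ext branch(4,5)] branch(7)
      by (simp add: F_def)
    also have "\<dots> = card ({S \<in> F. S \<inter> set xs \<noteq> {}} \<union> {S \<in> F. S \<inter> set xs = {}})"
      using finF by (intro card_Un_disjoint[symmetric]) auto
    also have "{S \<in> F. S \<inter> set xs \<noteq> {}} \<union> {S \<in> F. S \<inter> set xs = {}} = F" by auto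
    finally show ?case using ext self[OF branch(1) ext] by (simp add: F_def)
  next
    case (Cons R P X x xs T Ts t t' s)
    note I = call_invD[OF G Cons(1)]
    let ?P = "{y \<in> P. y \<noteq> x \<and> linked G x y}"
    let ?bad = "\<lambda>A. {y \<in> A. \<not> extendable G (insert y R)}"
    let ?A = "extendable_between G (insert x R) ?P"
    let ?B = "{S \<in> extendable_between G R (P - {x}). S \<inter> set xs \<noteq> {}}"
    let ?C = "{S \<in> extendable_between G R P. S \<inter> set (x # xs) \<noteq> {}}"
    show ?case
    proof
      assume ext: "extendable G R"
      have fin: "finite ?A" "finite ?B" "finite ?C"
        using I(9,10) by (simp_all add: finite_extendable_between)
      have "x \<notin> R" using I(4) Cons(2) by auto
      \<comment> \<open>Sets in \<open>?A\<close> contain \<open>x\<close>; those in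
        \<open>?B\<close> lie in \<open>R \<union> (P - {x})\<close> and do not.\<close>
      then have "?A \<inter> ?B = {}" by (auto simp: extendable_between_def)
      moreover have "?A \<union> ?B \<subseteq> ?C" using Cons(2) by (auto simp: extendable_between_def)
      ultimately have AB: "card ?A + card ?B \<le> card ?C"
        using fin card_mono[of ?C "?A \<union> ?B"] card_Un_disjoint[of ?A ?B] by simp
      have B: "card ?B \<le> card ?C"
        using AB by simp
      have rest: "(\<Sum>T\<leftarrow>Ts. leaves T) \<le> card ?B + card (?bad (set xs))"
        using Cons(6) ext by blast
      have "card (?bad (set (x # xs))) =
          (if extendable G (insert x R) then 0 else 1) + card (?bad (set xs))"
      proof (cases "extendable G (insert x R)")
        case True
        then have "?bad (set (x # xs)) = ?bad (set xs)" by auto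
        with True show ?thesis by simp
      next
        case False
        then have "?bad (set (x # xs)) = insert x (?bad (set xs))" by auto
        moreover have "x \<notin> ?bad (set xs)" using Cons(3) by auto
        ultimately show ?thesis using False by simp
      qed
      with rest AB B Cons(8)
      show "(\<Sum>T\<leftarrow>T # Ts. leaves T) \<le> card ?C + card (?bad (set (x # xs)))"
        by (simp split: if_splits)
    qed
  }
qed simp


section \<open>The running time of a call\<close>

text \<open>The factor \<open>max_biclique_size G + 2 - card R\<close> acts as a potential that
  drops by one per level. Branching needs \<open>card R\<close> at most the maximal size, so
  children exceed it by at most one and the factor stays positive.\<close>

lemma bkmbe_time_le:
  assumes G: "bipartite_graph G" and "bkmbe G R P X T t" "call_inv G u R P X"
    and W: "W = M * max_degree G" "M \<ge> 1" "max_degree G \<ge> 1" "card (nbrP G u) \<le> M"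
    and R: "card R \<le> Suc (max_biclique_size G)"
  shows "t \<le> 16 * W * (max_biclique_size G + 2 - card R) * leaves T"
proof -
  let ?q = "max_biclique_size G"
  have MW: "M \<le> W" "1 \<le> W" using W by (auto simp: Suc_le_eq)
  have "card R \<le> Suc ?q \<longrightarrow> t \<le> 16 * W * (?q + 2 - card R) * leaves T"
    using assms(1-3)
  proof (induction rule: bkmbe_induct[where
        \<Psi> = "\<lambda>R P X xs Ts t. card R \<le> ?q \<longrightarrow>
          t \<le> 1 + 8 * W * length Ts + 16 * W * (?q + 1 - card R) * (\<Sum>T\<leftarrow>Ts. leaves T)"])
    case (report R P X t)
    show ?case
    proof
      assume "card R \<le> Suc ?q"
      then have "16 * W * 1 \<le> 16 * W * (?q + 2 - card R)" by (intro mult_le_mono) auto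
      then have "16 * W \<le> 16 * W * (?q + 2 - card R)" by simp
      then show "t \<le> 16 * W * (?q + 2 - card R) * leaves (Call (Some (R \<union> P)) [])"
        using report(3) call_inv_cards(1)[OF G report(1)] W(4) MW unfolding leaves.simps simp_thms if_True mult_1_right by linarith
    qed
  next
    case (prune R P X)
    show ?case
    proof
      assume "card R \<le> Suc ?q"
      then have "16 * W * 1 \<le> 16 * W * (?q + 2 - card R)" by (intro mult_le_mono) auto
      then show "1 \<le> 16 * W * (?q + 2 - card R) * leaves (Call None [])"
        using MW by simp
    qed
  next
    case (branch R P X p xs Ts s t)
    note I = call_invD[OF G branch(1)]
    have "extendable G R"
      unfolding extendable_iff[OF G branch(1)]
      using branch(2,3) I(8) by (auto simp: no_extension_def not_maximal_def)
    then have q: "card R \<le> ?q"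
      using I by (intro card_extendable_le[OF G]) auto
    define c where "c = ?q + 1 - card R"
    \<comment> \<open>The children use only the factor \<open>c\<close>. The remaining
      \<open>16 * W * l\<close> pays for the call itself and for its loop, with
      \<open>8 * W * l\<close> each.\<close>
    have c: "?q + 2 - card R = Suc c" using q by (simp add: c_def)
    define l where "l = (\<Sum>T\<leftarrow>Ts. leaves T)"
    have s: "s \<le> 1 + 8 * W * length Ts + 16 * W * c * l"
      using branch(8) q by (simp add: c_def l_def)
    have "card (P \<union> X) * (2 + max_degree G) \<le> M * (2 + max_degree G)"
      using call_inv_cards(5)[OF G branch(1)] W(4) by (intro mult_le_mono) auto
    also have "\<dots> = 2 * M + W" using W(1) by (simp add: algebra_simps)
    also have "\<dots> \<le> 3 * W" using MW by linarith
    finally have t: "t \<le> 8 * W + 8 * W * length Ts + 16 * W * c * l"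
      using branch(9) s call_inv_cards(3)[OF G branch(1)] W(4) MW by linarith
    have "t \<le> 16 * W * Suc c * leaves (Call None Ts)"
    \<comment> \<open>A call whose pivot set is empty makes no recursive call; it counts as one leaf
      although \<open>l\<close> is zero.\<close>
    proof (cases "Ts = []")
      case True
      then show ?thesis using t by (simp add: l_def)
    next
      case False
      then have "1 \<le> length Ts" by (simp add: Suc_le_eq)
      then have l: "length Ts \<le> l" "1 \<le> l"
        using length_le_sum_leaves[of Ts] by (auto simp: l_def)
      have "8 * W * length Ts \<le> 8 * W * l" "8 * W * 1 \<le> 8 * W * l"
        using l by (intro mult_le_mono; simp)+
      with t have "t \<le> 16 * W * l + 16 * W * c * l" by linarith
      then show ?thesis using False by (simp add: l_def algebra_simps)
    qed
    with c show ?case by simp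
  next
    case (Nil R P X)
    then show ?case by simp
  next
    case (Cons R P X x xs T Ts t t' s)
    note I = call_invD[OF G Cons(1)]
    show ?case
    proof
      assume q: "card R \<le> ?q"
      define c where "c = ?q + 1 - card R"
      have "x \<notin> R" using I(4) Cons(2) by auto
      then have "card (insert x R) = Suc (card R)" using I(9) by simp
      then have "t \<le> 16 * W * c * leaves T"
        using Cons(8) q by (simp add: c_def)
      moreover have "t' \<le> 1 + 8 * W * length Ts + 16 * W * c * (\<Sum>T\<leftarrow>Ts. leaves T)"
        using Cons(6) q by (simp add: c_def)
      moreover have "4 + card R + card P + card X \<le> 8 * W"
        using call_inv_cards(2-4)[OF G Cons(1)] W(4) MW by linarith
      ultimately have "s \<le> 1 + 8 * W * length (T # Ts) + 16 * W * c * (\<Sum>T\<leftarrow>T # Ts. leaves T)"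
        using Cons(7) by (simp add: algebra_simps)
      then show "s \<le> 1 + 8 * W * length (T # Ts) + 16 * W * (?q + 1 - card R) * (\<Sum>T\<leftarrow>T # Ts. leaves T)"
        by (simp add: c_def)
    qed
  qed
  with R show ?thesis by blast
qed


section \<open>The total number of leaves\<close>

lemma bbk_calls_ConsE:
  assumes "(Ts, t) \<in> bbk_calls G N2 D (u # us)" "N2 u = nbr2 G u"
  obtains T Ts' t1 t2 where "Ts = T # Ts'"
    "bkmbe G {u} (nbrP G u - D) (nbrP G u \<inter> D) T t1"
    "(Ts', t2) \<in> bbk_calls G N2 (insert u D) us" "t \<le> 3 + 2 * card (nbrP G u) + t1 + t2"
proof -
  obtain P X T Ts' s1 s2 t1 t2 where
    PX: "(P, s1) \<in> filter_set (\<lambda>x. x \<notin> D) (nbrP G u)" "(X, s2) \<in> filter_set (\<lambda>x. x \<in> D) (nbrP G u)"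
    and *: "bkmbe G {u} P X T t1" "(Ts', t2) \<in> bbk_calls G N2 (insert u D) us" "Ts = T # Ts'"
    "t = 1 + (s1 + (s2 + (t1 + t2)))"
    using assms by (auto simp: prog_iff nbrP_def)
  have "P = nbrP G u - D" "X = nbrP G u \<inter> D"
    using filter_set_outcome[OF PX(1)] filter_set_outcome[OF PX(2)] by auto
  moreover have "t \<le> 3 + 2 * card (nbrP G u) + t1 + t2"
    using filter_set_cost[OF PX(1)] filter_set_cost[OF PX(2)] *(4) by linarith
  ultimately show thesis using that * by blast
qed

text \<open>A right vertex of \<open>C\<close> lies on a path of length two from \<open>u\<close> to
  any other left vertex of \<open>C\<close>; this is where both sides being occupied
  matters.\<close>

lemma biclique_subset_nbrP:
  assumes "biclique G C" "two_sided G C" "u \<in> C" "u \<in> left G"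
  shows "C \<subseteq> insert u (nbrP G u)"
proof
  fix y assume y: "y \<in> C"
  obtain v where v: "v \<in> C" "v \<in> right G" using assms(2) by (auto simp: two_sided_def)
  then have uv: "v \<in> nbr G u" using assms by (auto simp: biclique_def)
  consider "y \<in> right G" | "y \<in> left G" using assms(1) y by (auto simp: biclique_def)
  then show "y \<in> insert u (nbrP G u)"
  proof cases
    case 1
    then show ?thesis using assms y by (auto simp: biclique_def nbrP_def)
  next
    case 2
    then have "v \<in> nbr G y" using assms(1) y v by (auto simp: biclique_def)
    then have "y \<in> nbr G v" by (auto simp: nbr_def)
    with uv show ?thesis by (auto simp: nbrP_def nbr2_def)
  qed
qed

text \<open>\<open>C\<close> is found below its first left vertex \<open>u\<close> in the order: the
  earlier vertices \<open>D\<close> are not in \<open>C\<close>, so the rest of \<open>C\<close>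
  lies in the initial \<open>P\<close>.\<close>

lemma bbk_calls_reports:
  assumes G: "bipartite_graph G" and N2: "\<And>u. u \<in> left G \<Longrightarrow> N2 u = nbr2 G u"
    and C: "maximal_biclique G C" "two_sided G C"
    and "(Ts, t) \<in> bbk_calls G N2 D us" "set us \<subseteq> left G" "C \<inter> D = {}" "C \<inter> set us \<noteq> {}"
  shows "\<exists>T\<in>set Ts. C \<in> reports T"
  using assms(5-)
proof (induction us arbitrary: D Ts t)
  case (Cons u us)
  have u: "u \<in> left G" using Cons.prems(2) by simp
  obtain T Ts' t1 t2 where T: "Ts = T # Ts'"
    "bkmbe G {u} (nbrP G u - D) (nbrP G u \<inter> D) T t1"
    "(Ts', t2) \<in> bbk_calls G N2 (insert u D) us" "t \<le> 3 + 2 * card (nbrP G u) + t1 + t2"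
    by (rule bbk_calls_ConsE[OF Cons.prems(1) N2[OF u]])
  show ?case
  proof (cases "u \<in> C")
    case True
    have "biclique G C" using C(1) by (simp add: maximal_biclique_def)
    from biclique_subset_nbrP[OF this C(2) True u]
    have "C \<subseteq> {u} \<union> (nbrP G u - D)" using Cons.prems(3) by auto
    then have "C \<in> reports T"
      using bkmbe_reports[OF G T(2) call_inv_root[OF G u] C(1)] True by blast
    with T(1) show ?thesis by simp
  next
    case False
    then have "\<exists>T\<in>set Ts'. C \<in> reports T"
      using Cons.IH[OF T(3)] Cons.prems by auto
    with T(1) show ?thesis by auto
  qed
qed simp

lemma bbk_calls_length:
  "(Ts, t) \<in> bbk_calls G N2 D us \<Longrightarrow> length Ts = length us"
  by (induction us arbitrary: D Ts t) (fastforce simp: prog_iff)+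

text \<open>With \<open>D\<close> the vertices already treated and \<open>A\<close> those to come,
  such a set is charged to its first vertex in the order.\<close>

definition extendable_sets :: "'a bigraph \<Rightarrow> 'a set \<Rightarrow> 'a set \<Rightarrow> 'a set set" where
  "extendable_sets G D A = {S. S \<subseteq> left G \<union> right G \<and> linked_set G S \<and> extendable G S \<and>
     S \<inter> D = {} \<and> S \<inter> A \<noteq> {}}"

lemma finite_extendable_sets: "bipartite_graph G \<Longrightarrow> finite (extendable_sets G D A)"
  by (rule finite_subset[of _ "Pow (left G \<union> right G)"])
     (auto simp: extendable_sets_def finite_vertices simp del: finite_Un)

text \<open>A neighbour of \<open>u\<close> makes \<open>{u}\<close> extendable, so the root falls
  under the counting bound. Sets charged to \<open>u\<close> contain it, while those charged later
  avoid it.\<close>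

lemma bbk_calls_leaves_le:
  assumes G: "bipartite_graph G" and N2: "\<And>u. u \<in> left G \<Longrightarrow> N2 u = nbr2 G u"
    and "(Ts, t) \<in> bbk_calls G N2 D us" "set us \<subseteq> left G" "distinct us" "D \<inter> set us = {}"
    and "\<And>u. u \<in> set us \<Longrightarrow> nbr G u \<noteq> {}"
  shows "num_leaves Ts \<le> card (extendable_sets G D (set us))"
  using assms(3-)
proof (induction us arbitrary: D Ts t)
  case Nil
  then show ?case by (simp add: prog_iff num_leaves_def)
next
  case (Cons u us)
  have u: "u \<in> left G" using Cons.prems(2) by simp
  obtain T Ts' t1 t2 where T: "Ts = T # Ts'"
    "bkmbe G {u} (nbrP G u - D) (nbrP G u \<inter> D) T t1"
    "(Ts', t2) \<in> bbk_calls G N2 (insert u D) us" "t \<le> 3 + 2 * card (nbrP G u) + t1 + t2"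
    by (rule bbk_calls_ConsE[OF Cons.prems(1) N2[OF u]])
  let ?A = "extendable_between G {u} (nbrP G u - D)"
  let ?B = "extendable_sets G (insert u D) (set us)"
  let ?C = "extendable_sets G D (set (u # us))"
  obtain v where "v \<in> nbr G u" using Cons.prems(5)[of u] by auto
  then have "extendable G {u}"
    using nbr_sides(1)[OF G u] by (auto simp: extendable_def linked_def)
  then have 1: "leaves T \<le> card ?A"
    using bkmbe_leaves_le[OF G T(2) call_inv_root[OF G u]] by simp
  have 2: "num_leaves Ts' \<le> card ?B"
    using Cons.IH[OF T(3)] Cons.prems by auto
  have "?A \<inter> ?B = {}" by (auto simp: extendable_between_def extendable_sets_def)
  moreover have "?A \<union> ?B \<subseteq> ?C"
    using Cons.prems(4) nbrP_sides[OF G u] u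
    by (fastforce simp: extendable_between_def extendable_sets_def)
  moreover have "finite ?A" "finite ?B" "finite ?C"
    using finite_extendable_sets[OF G] finite_nbr(3)[OF G, of u]
    by (auto intro!: finite_extendable_between)
  ultimately have "card ?A + card ?B \<le> card ?C"
    using card_mono[of ?C "?A \<union> ?B"] card_Un_disjoint[of ?A ?B] by simp
  with 1 2 T(1) show ?case by (simp add: num_leaves_def)
qed

text \<open>Union bound over the power sets of the two-sided maximal bicliques; meeting
  \<open>left G\<close> ensures that each counted set lies in one of them.\<close>

lemma card_extendable_sets_le:
  assumes "bipartite_graph G"
  shows "card (extendable_sets G {} (left G)) \<le> num_maximal_bicliques G * 2 ^ max_biclique_size G"
proof -
  let ?M = "{C. maximal_biclique G C \<and> two_sided G C}"
  have finM: "finite ?M"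
    using finite_bicliques[OF assms] by (rule rev_finite_subset) (auto simp: maximal_biclique_def)
  have fin: "finite C" if "biclique G C" for C
    using finite_subset[OF _ finite_vertices[OF assms]] that by (auto simp: biclique_def)
  have "extendable_sets G {} (left G) \<subseteq> (\<Union>C\<in>?M. Pow C)"
  proof
    fix S assume "S \<in> extendable_sets G {} (left G)"
    then obtain C where "S \<subseteq> C" "biclique G C" "two_sided G C"
      using extendable_biclique[OF assms, of S] by (auto simp: extendable_sets_def)
    moreover from this obtain M where "C \<subseteq> M" "maximal_biclique G M" "two_sided G M"
      using biclique_extends_to_maximal[OF assms, of C] by blast
    ultimately show "S \<in> (\<Union>C\<in>?M. Pow C)" by blast
  qed
  then have "card (extendable_sets G {} (left G)) \<le> card (\<Union>C\<in>?M. Pow C)"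
    using finM fin by (intro card_mono finite_UN_I) (auto simp: maximal_biclique_def)
  also have "\<dots> \<le> (\<Sum>C\<in>?M. card (Pow C))" by (rule card_UN_le[OF finM])
  also have "\<dots> \<le> (\<Sum>C\<in>?M. 2 ^ max_biclique_size G)"
    using card_biclique_le[OF assms] fin
    by (intro sum_mono) (auto simp: card_Pow maximal_biclique_def)
  also have "\<dots> = num_maximal_bicliques G * 2 ^ max_biclique_size G"
    by (simp add: num_maximal_bicliques_def)
  finally show ?thesis .
qed

lemma bbkE:
  assumes "bipartite_graph G" "(Ts, t) \<in> bbk G"
  obtains N2 us t1 t2 t3 where "\<And>u. u \<in> left G \<Longrightarrow> N2 u = nbr2 G u" "distinct us" "set us = left G"
    "(N2, t1) \<in> two_hop_table G" "(us, t2) \<in> compute_order G N2" "(Ts, t3) \<in> bbk_calls G N2 {} us"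
    "t = t1 + t2 + t3"
proof -
  obtain N2 us t1 t2 t3 where *: "(N2, t1) \<in> two_hop_table G" "(us, t2) \<in> compute_order G N2"
    "(Ts, t3) \<in> bbk_calls G N2 {} us" "t = t1 + t2 + t3"
    using assms(2) by (auto simp: bbk_def prog_iff)
  note N2 = two_hop_table_outcome[OF *(1)]
  have "distinct us" "set us = left G"
    using compute_order_outcome[OF assms(1) N2 *(2)] by (auto simp: bidegeneracy_order_def)
  with that N2 * show thesis by blast
qed

text \<open>The second inequality, one tree per left vertex, allows preprocessing linear in
  \<open>card (left G)\<close> to be charged to the leaves.\<close>

lemma bbk_leaves_ge:
  assumes G: "bipartite_graph G" and run: "(Ts, t) \<in> bbk G"
  shows "num_maximal_bicliques G \<le> num_leaves Ts" "card (left G) \<le> num_leaves Ts"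
proof -
  obtain N2 us t1 t2 t3 where N2: "\<And>u. u \<in> left G \<Longrightarrow> N2 u = nbr2 G u"
    and us: "distinct us" "set us = left G" and calls: "(Ts, t3) \<in> bbk_calls G N2 {} us"
    using bbkE[OF assms] by metis
  have fin: "finite (\<Union>T\<in>set Ts. reports T)" using reports_card by auto
  have "{C. maximal_biclique G C \<and> two_sided G C} \<subseteq> (\<Union>T\<in>set Ts. reports T)"
    using bbk_calls_reports[OF G N2 _ _ calls] us by (auto simp: two_sided_def)
  then have "num_maximal_bicliques G \<le> card (\<Union>T\<in>set Ts. reports T)"
    unfolding num_maximal_bicliques_def by (rule card_mono[OF fin])
  also have "\<dots> \<le> num_leaves Ts"
  proof (induction Ts)
    case (Cons T Ts)
    with reports_card[of T] card_Un_le[of "reports T" "\<Union>T\<in>set Ts. reports T"]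
    show ?case by (simp add: num_leaves_def)
  qed simp
  finally show "num_maximal_bicliques G \<le> num_leaves Ts" .
  show "card (left G) \<le> num_leaves Ts"
    using length_le_sum_leaves[of Ts] bbk_calls_length[OF calls] us distinct_card[of us]
    by (simp add: num_leaves_def)
qed

lemma bbk_leaves_le:
  assumes G: "bipartite_graph G" and run: "(Ts, t) \<in> bbk G"
    and nbr: "\<And>u. u \<in> left G \<Longrightarrow> nbr G u \<noteq> {}"
  shows "num_leaves Ts \<le> num_maximal_bicliques G * 2 ^ max_biclique_size G"
proof -
  obtain N2 us t1 t2 t3 where N2: "\<And>u. u \<in> left G \<Longrightarrow> N2 u = nbr2 G u"
    and us: "distinct us" "set us = left G" and calls: "(Ts, t3) \<in> bbk_calls G N2 {} us"
    using bbkE[OF G run] by metis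
  have "num_leaves Ts \<le> card (extendable_sets G {} (left G))"
    using bbk_calls_leaves_le[OF G N2 calls] us nbr by simp
  with card_extendable_sets_le[OF G] show ?thesis by (rule le_trans[rotated])
qed


section \<open>The total running time\<close>

lemma two_hop_cost:
  assumes G: "bipartite_graph G" and u: "u \<in> left G" and run: "(A, t) \<in> two_hop G u"
  shows "t \<le> 1 + max_left_degree G * (2 + max_degree G)"
proof -
  have "t \<le> 1 + card (nbr G u) * (1 + (1 + max_degree G))"
    using run unfolding two_hop_def
  proof (rule foreach_cost_le)
    fix v r r' b
    assume v: "v \<in> nbr G u"
      and "(r', b) \<in> foreach (nbr G v) (\<lambda>w B. ret (if w = u then B else insert w B)) r"
    then have "b \<le> 1 + card (nbr G v) * (1 + 0)"
      by (elim foreach_cost_le) (auto simp: prog_iff)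
    also have "card (nbr G v) \<le> max_degree G"
      using v nbr_sides(1)[OF G u] by (intro degree_bounds(1)[OF G]) auto
    finally show "b \<le> 1 + max_degree G" by simp
  qed
  also have "card (nbr G u) * (1 + (1 + max_degree G)) \<le> max_left_degree G * (1 + (1 + max_degree G))"
    by (rule mult_le_mono1) (rule degree_bounds(2)[OF G u])
  finally show ?thesis by simp
qed

lemma two_hop_table_cost:
  assumes G: "bipartite_graph G" and run: "(N2, t) \<in> two_hop_table G"
  shows "t \<le> 1 + card (left G) * (2 + max_left_degree G * (2 + max_degree G))"
proof -
  have "t \<le> 1 + card (left G) * (1 + (1 + max_left_degree G * (2 + max_degree G)))"
    using run unfolding two_hop_table_def
    by (rule foreach_cost_le) (auto simp: prog_iff dest!: two_hop_cost[OF G])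
  then show ?thesis by simp
qed

text \<open>The bucket search stops at the current degree of the extracted vertex, at most
  \<open>card (nbrP G u)\<close>, and the updates touch only its second neighbours. Restarting the
  search from zero is thus affordable.\<close>

lemma extract_min_cost:
  assumes G: "bipartite_graph G" and N2: "\<And>u. u \<in> left G \<Longrightarrow> N2 u = nbr2 G u"
    and inv: "order_inv G n s" and run: "(s', t) \<in> extract_min N2 s"
  shows "t \<le> 3 + 2 * (max_left_degree G + max_left_degree2 G)"
proof -
  obtain us D deg bkt where s: "s = (us, D, deg, bkt)" by (cases s)
  from run s obtain k u deg' bkt' t' where u: "u \<in> bkt k"
    and low: "((deg', bkt'), t') \<in> lower_degrees (insert u D) (N2 u) (deg, bkt(k := bkt k - {u}))"
    and t: "t = Suc k + (1 + t')"
    unfolding extract_min_def first_index_def pick_def by (clarsimp simp: prog_iff)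
  have uk: "u \<in> left G" "k = card (nbrP G u - D)"
    using inv s u by (auto simp: order_inv_def buckets_ok_def)
  have "k \<le> card (nbrP G u)"
    unfolding uk(2) by (rule card_mono) (use finite_nbr(3)[OF G] in auto)
  moreover have "t' \<le> 1 + card (N2 u) * (1 + 0)"
    using low unfolding lower_degrees_def
    by (rule foreach_cost_le) (auto simp: prog_iff Let_def split: prod.splits if_splits)
  ultimately show ?thesis
    using t N2[OF uk(1)] degree_bounds(3,4)[OF G uk(1)] by simp
qed

lemma repeat_extract_min_cost:
  assumes "bipartite_graph G" "\<And>u. u \<in> left G \<Longrightarrow> N2 u = nbr2 G u"
    "order_inv G n s" "(s', t) \<in> repeat_prog m (extract_min N2) s"
  shows "t \<le> m * (4 + 2 * (max_left_degree G + max_left_degree2 G))"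
  using assms(3,4)
proof (induction m arbitrary: n s t)
  case 0
  then show ?case by (simp add: prog_iff)
next
  case (Suc m)
  then obtain r a b where r: "(r, a) \<in> extract_min N2 s" "(s', b) \<in> repeat_prog m (extract_min N2) r"
    "t = 1 + (a + b)"
    by (auto simp: prog_iff)
  from Suc.IH[OF extract_min_outcome[OF assms(1,2) Suc.prems(1) r(1)] r(2)]
    extract_min_cost[OF assms(1,2) Suc.prems(1) r(1)] r(3)
  show ?case by simp
qed

lemma compute_order_cost:
  assumes G: "bipartite_graph G" and N2: "\<And>u. u \<in> left G \<Longrightarrow> N2 u = nbr2 G u"
    and run: "(us, t) \<in> compute_order G N2"
  shows "t \<le> 1 + card (left G) * (5 + 2 * (max_left_degree G + max_left_degree2 G))"
proof -
  from run obtain deg bkt t1 s t2 where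
    1: "((deg, bkt), t1) \<in> init_buckets G N2" and
    2: "(s, t2) \<in> repeat_prog (card (left G)) (extract_min N2) ([], {}, deg, bkt)" and
    t: "t = t1 + t2"
    by (auto simp: compute_order_def prog_iff)
  have "t1 \<le> 1 + card (left G) * (1 + 0)"
    using 1 unfolding init_buckets_def
    by (rule foreach_cost_le) (auto simp: prog_iff Let_def split: prod.splits)
  with repeat_extract_min_cost[OF G N2 order_inv_init[OF G N2 1] 2] t show ?thesis
    by (simp add: algebra_simps)
qed

section \<open>Cost of the root calls and of the whole run\<close>

lemma bbk_calls_cost:
  assumes G: "bipartite_graph G" and N2: "\<And>u. u \<in> left G \<Longrightarrow> N2 u = nbr2 G u"
    and M: "M = max_left_degree G + max_left_degree2 G" "M \<ge> 1" "max_degree G \<ge> 1"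
    and "(Ts, t) \<in> bbk_calls G N2 D us" "set us \<subseteq> left G"
  shows "t \<le> 1 + (3 + 2 * M) * length us +
    16 * (M * max_degree G) * (max_biclique_size G + 1) * num_leaves Ts"
  using assms(6-)
proof (induction us arbitrary: D Ts t)
  case Nil
  then show ?case by (simp add: prog_iff)
next
  case (Cons u us)
  have u: "u \<in> left G" using Cons.prems(2) by simp
  obtain T Ts' t1 t2 where T: "Ts = T # Ts'"
    "bkmbe G {u} (nbrP G u - D) (nbrP G u \<inter> D) T t1"
    "(Ts', t2) \<in> bbk_calls G N2 (insert u D) us" "t \<le> 3 + 2 * card (nbrP G u) + t1 + t2"
    by (rule bbk_calls_ConsE[OF Cons.prems(1) N2[OF u]])
  have le: "card (nbrP G u) \<le> M" using degree_bounds(4)[OF G u] M(1) by simp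
  define K where "K = 16 * (M * max_degree G) * (max_biclique_size G + 1)"
  \<comment> \<open>A root has \<open>card R = 1\<close>, which turns
    \<open>max_biclique_size G + 2 - card R\<close> into the factor in \<open>K\<close>.\<close>
  have "t1 \<le> K * leaves T"
    using bkmbe_time_le[OF G T(2) call_inv_root[OF G u] refl M(2,3) le] by (simp add: K_def)
  moreover have "t2 \<le> 1 + (3 + 2 * M) * length us + K * num_leaves Ts'"
    using Cons.IH[OF T(3)] Cons.prems(2) by (simp add: K_def)
  ultimately have "t \<le> 1 + (3 + 2 * M) * length (u # us) + K * num_leaves Ts"
    using T(1,4) le by (simp add: num_leaves_def algebra_simps)
  then show ?case by (simp add: K_def)
qed

lemma bbk_cost:
  assumes G: "bipartite_graph G" and E: "edges G \<noteq> {}" and run: "(Ts, t) \<in> bbk G"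
  shows "t \<le> 50 * (num_leaves Ts * (max_left_degree G + max_left_degree2 G) *
    max_degree G * max_biclique_size G)"
proof -
  obtain N2 us t1 t2 t3 where N2: "\<And>u. u \<in> left G \<Longrightarrow> N2 u = nbr2 G u"
    and us: "distinct us" "set us = left G"
    and runs: "(N2, t1) \<in> two_hop_table G" "(us, t2) \<in> compute_order G N2"
      "(Ts, t3) \<in> bbk_calls G N2 {} us"
    and t: "t = t1 + t2 + t3"
    using bbkE[OF G run] by metis
  define M where "M = max_left_degree G + max_left_degree2 G"
  define d where "d = max_degree G"
  define q where "q = max_biclique_size G"
  define W where "W = M * d"
  define l where "l = num_leaves Ts"
  note pos = edge_degrees[OF G E]
  have M: "1 \<le> M" "1 \<le> d" "2 \<le> q" using pos by (simp_all add: M_def d_def q_def)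
  have W: "M \<le> W" "1 \<le> W" using M by (auto simp: W_def Suc_le_eq)
  have n: "card (left G) \<le> l" using bbk_leaves_ge[OF G run] by (simp add: l_def)
  have l: "1 \<le> l"
    using n pos(5) G by (metis One_nat_def Suc_leI bipartite_graph_def card_gt_0_iff le_trans)
  have len: "length us = card (left G)" using us distinct_card by metis
  have "max_left_degree G * (2 + d) \<le> M * (2 + d)" by (rule mult_le_mono1) (simp add: M_def)
  also have "\<dots> = 2 * M + W" by (simp add: W_def algebra_simps)
  finally have "2 + max_left_degree G * (2 + d) \<le> 5 * W" using W by linarith
  then have "card (left G) * (2 + max_left_degree G * (2 + d)) \<le> l * (5 * W)"
    using n by (intro mult_le_mono)
  then have 1: "t1 \<le> 1 + 5 * (l * W)"
    using two_hop_table_cost[OF G runs(1)] by (simp add: d_def)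
  have "card (left G) * (5 + 2 * M) \<le> l * (7 * W)"
    using n W by (intro mult_le_mono) linarith+
  then have 2: "t2 \<le> 1 + 7 * (l * W)"
    using compute_order_cost[OF G N2 runs(2)] by (simp add: M_def)
  have "(3 + 2 * M) * length us \<le> (5 * W) * l"
    unfolding len using n W by (intro mult_le_mono) linarith+
  then have 3: "t3 \<le> 1 + 5 * (l * W) + 16 * (l * W) * (q + 1)"
    using bbk_calls_cost[OF G N2 M_def _ _ runs(3)] M us
    by (simp add: M_def[symmetric] d_def[symmetric] q_def[symmetric] l_def[symmetric] W_def mult_ac)
  have lW: "1 \<le> l * W" using l W by (simp add: Suc_le_eq)
  \<comment> \<open>The \<open>36\<close> is \<open>5 + 7 + 5\<close> from the linear terms,
    \<open>16\<close> from the summand \<open>1\<close> in \<open>q + 1\<close>, and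
    \<open>3\<close> from the three isolated ones.\<close>
  then have "t \<le> 36 * (l * W) + 16 * (l * W * q)"
    using 1 2 3 t by (simp only: distrib_left mult_1_right mult.assoc)
  \<comment> \<open>As \<open>q\<close> is at least 2, \<open>36 * (l * W)\<close> is at most
    \<open>18 * (l * W * q)\<close>; the total of \<open>34\<close> is below
    \<open>50\<close>.\<close>
  also have "l * W * 2 \<le> l * W * q" using M by (intro mult_le_mono) auto
  then have "36 * (l * W) + 16 * (l * W * q) \<le> 50 * (l * W * q)" by linarith
  finally show ?thesis
    by (simp add: W_def M_def d_def q_def l_def mult_ac)
qed

theorem theorem3:
  shows "(\<forall>(G :: 'a bigraph) Ts t.
            bipartite_graph G \<and> edges G \<noteq> {} \<and> (Ts, t) \<in> bbk G \<longrightarrow>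
              1 \<le> 1 / leaf_ratio G Ts \<and>
              ((\<forall>u\<in>left G. nbr G u \<noteq> {}) \<longrightarrow>
                1 / leaf_ratio G Ts \<le> 2 ^ max_biclique_size G)) \<and>
         (\<lambda>(G :: 'a bigraph, Ts, t). real t)
           \<in> O[principal {(G, Ts, t). bipartite_graph G \<and> edges G \<noteq> {} \<and> (Ts, t) \<in> bbk G}](
             \<lambda>(G, Ts, t). 1 / leaf_ratio G Ts *
               (real (max_left_degree G) + real (max_left_degree2 G)) *
               real (max_degree G) * real (max_biclique_size G) *
               real (num_maximal_bicliques G))"
proof (intro conjI allI impI)
  fix G :: "'a bigraph" and Ts t
  assume *: "bipartite_graph G \<and> edges G \<noteq> {} \<and> (Ts, t) \<in> bbk G"
  then have B: "1 \<le> num_maximal_bicliques G" using edge_degrees(4) by blast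
  show "1 \<le> 1 / leaf_ratio G Ts"
    using bbk_leaves_ge(1)[of G Ts t] * B by (simp add: leaf_ratio_def)
  assume "\<forall>u\<in>left G. nbr G u \<noteq> {}"
  then have "num_leaves Ts \<le> num_maximal_bicliques G * 2 ^ max_biclique_size G"
    using bbk_leaves_le[of G Ts t] * by blast
  then have "real (num_leaves Ts) \<le> real (num_maximal_bicliques G * 2 ^ max_biclique_size G)"
    by (rule of_nat_mono)
  then show "1 / leaf_ratio G Ts \<le> 2 ^ max_biclique_size G"
    using B by (simp add: leaf_ratio_def field_simps)
next
  show "(\<lambda>(G :: 'a bigraph, Ts, t). real t)
           \<in> O[principal {(G, Ts, t). bipartite_graph G \<and> edges G \<noteq> {} \<and> (Ts, t) \<in> bbk G}](
             \<lambda>(G, Ts, t). 1 / leaf_ratio G Ts *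
               (real (max_left_degree G) + real (max_left_degree2 G)) *
               real (max_degree G) * real (max_biclique_size G) *
               real (num_maximal_bicliques G))"
  \<comment> \<open>Over a principal filter the bound must hold for every admissible run, which the
    uniform constant \<open>50\<close> of \<open>bbk_cost\<close> provides.\<close>
  proof (rule bigoI[where c = 50], unfold eventually_principal, clarify)
    fix G :: "'a bigraph" and Ts t
    assume G: "bipartite_graph G" "edges G \<noteq> {}" "(Ts, t) \<in> bbk G"
    have B: "num_maximal_bicliques G > 0" using edge_degrees(4)[OF G(1,2)] by simp
    have "real t \<le> real (50 * (num_leaves Ts * (max_left_degree G + max_left_degree2 G) *
        max_degree G * max_biclique_size G))"
      by (rule of_nat_mono) (rule bbk_cost[OF G])
    \<comment> \<open>With a positive number of maximal bicliques, that number times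
      \<open>1 / leaf_ratio G Ts\<close> is the number of leaves.\<close>
    also have "\<dots> = 50 * (1 / leaf_ratio G Ts *
               (real (max_left_degree G) + real (max_left_degree2 G)) *
               real (max_degree G) * real (max_biclique_size G) *
               real (num_maximal_bicliques G))"
      using B by (simp add: leaf_ratio_def)
    finally show "norm (real t) \<le> 50 * norm (1 / leaf_ratio G Ts *
               (real (max_left_degree G) + real (max_left_degree2 G)) *
               real (max_degree G) * real (max_biclique_size G) *
               real (num_maximal_bicliques G))"
      by (simp add: leaf_ratio_def)
  qed
qed

end
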